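(* Temporal Firefighter can be solved in time $O(\Lambda n^5 3^{2\omega})$, where the input temporal graph has $n$ vertices, lifetime $\Lambda$ and VIM width $\omega$.
   Context: A temporal graph $\mathcal{G}=(G,\lambda)$: static graph $G=(V,E)$ and $\lambda:E\to 2^{\mathbb{N}}$; time-edges $(e,t)$ with $t\in\lambda(e)$; lifetime $\Lambda=\max_e\max\lambda(e)$. VIM width: with $F_t=\{v:\exists u,w,\ \min\lambda(vu)\le t\le\max\lambda(vw)\}$ for $t\in[\Lambda]$, $\omega=\max_t|F_t|$. Temporal Firefighter: input a rooted temporal graph $(\mathcal{G},r)$ and an integer $h$. Initially only $r$ is burning. At each timestep $t=1,2,\dots,\Lambda$, a vertex that is neither burning nor defended may be defended (a strategy is the sequence of these choices), after which the fire spreads along every edge active at time $t$ from a burning endpoint to an endpoint that is neither burning nor defended. A vertex is saved if it never burns. The question is whether some strategy saves at least $h$ vertices. *)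

theory Defs
  imports Main
begin

section \<open>Temporal graphs, lifetime and VIM width\<close>

record 'a tgraph =
  verts :: "'a set"
  edges :: "'a set set"
  labels :: "'a set \<Rightarrow> nat set"

text \<open>Edges that are never active and the label \<open>0\<close> are not excluded; the fire only acts at the
  timesteps \<open>1, 2, \<dots>\<close>.\<close>

definition temporal_graph :: "'a tgraph \<Rightarrow> bool" where
  "temporal_graph G \<longleftrightarrow>
     finite (verts G) \<and>
     (\<forall>e\<in>edges G. \<exists>u\<in>verts G. \<exists>v\<in>verts G. u \<noteq> v \<and> e = {u, v}) \<and>
     (\<forall>e\<in>edges G. finite (labels G e))"

text \<open>The inserted \<open>0\<close> only matters when the maximum would be taken over the empty set.\<close>

definition lifetime :: "'a tgraph \<Rightarrow> nat" where
  "lifetime G = Max (insert 0 (\<Union>e\<in>edges G. labels G e))"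

text \<open>The nonemptiness conditions keep \<open>Min\<close> and \<open>Max\<close> meaningful: an edge that is never active
  puts no vertex into any bag.\<close>

definition vim_bag :: "'a tgraph \<Rightarrow> nat \<Rightarrow> 'a set" where
  "vim_bag G t = {v \<in> verts G. \<exists>u w.
     {v, u} \<in> edges G \<and> labels G {v, u} \<noteq> {} \<and>
     {v, w} \<in> edges G \<and> labels G {v, w} \<noteq> {} \<and>
     Min (labels G {v, u}) \<le> t \<and> t \<le> Max (labels G {v, w})}"

definition vim_width :: "'a tgraph \<Rightarrow> nat" where
  "vim_width G = Max (insert 0 ((\<lambda>t. card (vim_bag G t)) ` {1..lifetime G}))"


section \<open>Temporal Firefighter\<close>

text \<open>\<open>\<sigma> t\<close> is the vertex defended at timestep \<open>t\<close>, if any; only \<open>1 \<le> t \<le> lifetime G\<close> matters.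
  \<open>fire G r \<sigma> t\<close> is the pair of the burning and the defended vertices after timestep \<open>t\<close>.\<close>

fun fire :: "'a tgraph \<Rightarrow> 'a \<Rightarrow> (nat \<Rightarrow> 'a option) \<Rightarrow> nat \<Rightarrow> 'a set \<times> 'a set" where
  "fire G r \<sigma> 0 = ({r}, {})"
| "fire G r \<sigma> (Suc t) =
     (let (B, D) = fire G r \<sigma> t; D' = D \<union> set_option (\<sigma> (Suc t))
      in (B \<union> {v \<in> verts G. v \<notin> D' \<and>
               (\<exists>u\<in>B. {u, v} \<in> edges G \<and> Suc t \<in> labels G {u, v})}, D'))"

definition burning :: "'a tgraph \<Rightarrow> 'a \<Rightarrow> (nat \<Rightarrow> 'a option) \<Rightarrow> nat \<Rightarrow> 'a set" where
  "burning G r \<sigma> t = fst (fire G r \<sigma> t)"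

definition defended :: "'a tgraph \<Rightarrow> 'a \<Rightarrow> (nat \<Rightarrow> 'a option) \<Rightarrow> nat \<Rightarrow> 'a set" where
  "defended G r \<sigma> t = snd (fire G r \<sigma> t)"

definition strategy :: "'a tgraph \<Rightarrow> 'a \<Rightarrow> (nat \<Rightarrow> 'a option) \<Rightarrow> bool" where
  "strategy G r \<sigma> \<longleftrightarrow>
     (\<forall>t\<in>{1..lifetime G}. \<forall>v. \<sigma> t = Some v \<longrightarrow>
        v \<in> verts G \<and> v \<notin> burning G r \<sigma> (t - 1) \<and> v \<notin> defended G r \<sigma> (t - 1))"

definition saved :: "'a tgraph \<Rightarrow> 'a \<Rightarrow> (nat \<Rightarrow> 'a option) \<Rightarrow> 'a set" where
  "saved G r \<sigma> = verts G - burning G r \<sigma> (lifetime G)"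

definition temporal_firefighter :: "'a tgraph \<Rightarrow> 'a \<Rightarrow> int \<Rightarrow> bool" where
  "temporal_firefighter G r h \<longleftrightarrow> (\<exists>\<sigma>. strategy G r \<sigma> \<and> h \<le> int (card (saved G r \<sigma>)))"


section \<open>Unit-cost random access programs\<close>

text \<open>Running time is the unit-cost measure of a random access machine with integer cells whose
  arithmetic is addition and subtraction only (with multiplication, unit cost would be
  unrealistically cheap). For readability the machine is given as structured programs with finitely
  many named integer arrays in place of jumps and one interleaved memory. A scalar \<open>x\<close> is the array
  cell \<open>x[0]\<close>.\<close>

type_synonym store = "string \<Rightarrow> int \<Rightarrow> int"

datatype aexp =
    Num int
  | Get string aexp
  | Add aexp aexp
  | Sub aexp aexp

datatype bexp =
    Less aexp aexp
  | Equal aexp aexp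
  | Neg bexp
  | Conj bexp bexp

datatype com =
    Skip
  | Put string aexp aexp
  | Seq com com
  | Cond bexp com com
  | While bexp com

fun aval :: "aexp \<Rightarrow> store \<Rightarrow> int" where
  "aval (Num k) s = k"
| "aval (Get x a) s = s x (aval a s)"
| "aval (Add a b) s = aval a s + aval b s"
| "aval (Sub a b) s = aval a s - aval b s"

fun acost :: "aexp \<Rightarrow> nat" where
  "acost (Num k) = 1"
| "acost (Get x a) = acost a + 1"
| "acost (Add a b) = acost a + acost b + 1"
| "acost (Sub a b) = acost a + acost b + 1"

fun bval :: "bexp \<Rightarrow> store \<Rightarrow> bool" where
  "bval (Less a b) s \<longleftrightarrow> aval a s < aval b s"
| "bval (Equal a b) s \<longleftrightarrow> aval a s = aval b s"
| "bval (Neg b) s \<longleftrightarrow> \<not> bval b s"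
| "bval (Conj b c) s \<longleftrightarrow> bval b s \<and> bval c s"

fun bcost :: "bexp \<Rightarrow> nat" where
  "bcost (Less a b) = acost a + acost b + 1"
| "bcost (Equal a b) = acost a + acost b + 1"
| "bcost (Neg b) = bcost b + 1"
| "bcost (Conj b c) = bcost b + bcost c + 1"

text \<open>\<open>exec c s T s'\<close>: started in store \<open>s\<close>, \<open>c\<close> halts after exactly \<open>T\<close> steps in store \<open>s'\<close>.\<close>

inductive exec :: "com \<Rightarrow> store \<Rightarrow> nat \<Rightarrow> store \<Rightarrow> bool" where
  Skip: "exec Skip s 1 s"
| Put: "exec (Put x a b) s (acost a + acost b + 1) (s(x := (s x)(aval a s := aval b s)))"
| Seq: "exec c s T s' \<Longrightarrow> exec d s' U s'' \<Longrightarrow> exec (Seq c d) s (T + U) s''"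
| CondTrue: "bval b s \<Longrightarrow> exec c s T s' \<Longrightarrow> exec (Cond b c d) s (bcost b + 1 + T) s'"
| CondFalse: "\<not> bval b s \<Longrightarrow> exec d s T s' \<Longrightarrow> exec (Cond b c d) s (bcost b + 1 + T) s'"
| WhileFalse: "\<not> bval b s \<Longrightarrow> exec (While b c) s (bcost b + 1) s"
| WhileTrue: "bval b s \<Longrightarrow> exec c s T s' \<Longrightarrow> exec (While b c) s' U s'' \<Longrightarrow>
    exec (While b c) s (bcost b + 1 + T + U) s''"

inductive_cases exec_SkipE: "exec Skip s T s'"
  and exec_PutE: "exec (Put x a b) s T s'"
  and exec_SeqE: "exec (Seq c d) s T s'"
  and exec_CondE: "exec (Cond b c d) s T s'"
  and exec_WhileE: "exec (While b c) s T s'"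

lemma exec_deterministic:
  "exec c s T s' \<Longrightarrow> exec c s U s'' \<Longrightarrow> U = T \<and> s'' = s'"
proof (induction arbitrary: U s'' rule: exec.induct)
  case (Skip s)
  from Skip show ?case by (rule exec_SkipE) simp
next
  case (Put x a b s)
  from Put show ?case by (rule exec_PutE) simp
next
  case (Seq c s T s' d V s2)
  from Seq.prems show ?case by (rule exec_SeqE) (metis Seq.IH)
next
  case (CondTrue b s c T s' d)
  from CondTrue.prems show ?case
    by (rule exec_CondE) (use CondTrue.hyps(1) in \<open>auto dest: CondTrue.IH\<close>)
next
  case (CondFalse b s d T s' c)
  from CondFalse.prems show ?case
    by (rule exec_CondE) (use CondFalse.hyps(1) in \<open>auto dest: CondFalse.IH\<close>)
next
  case (WhileFalse b s c)
  from WhileFalse.prems show ?case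
    by (rule exec_WhileE) (use WhileFalse.hyps in auto)
next
  case (WhileTrue b s c T s' V s2)
  from WhileTrue.prems show ?case
    by (rule exec_WhileE) (use WhileTrue.hyps(1) in \<open>auto dest!: WhileTrue.IH\<close>)
qed


section \<open>Input encoding\<close>

text \<open>A temporal graph is presented as a list of its edges, each given by its two endpoints and a
  list of its labels. All orders are arbitrary.\<close>

definition enumerates :: "(nat \<times> nat \<times> nat list) list \<Rightarrow> nat tgraph \<Rightarrow> bool" where
  "enumerates es G \<longleftrightarrow>
     distinct (map (\<lambda>(u, v, ts). {u, v}) es) \<and>
     (\<lambda>(u, v, ts). {u, v}) ` set es = edges G \<and>
     (\<forall>(u, v, ts)\<in>set es. distinct ts \<and> set ts = labels G {u, v})"

definition arr :: "int list \<Rightarrow> int \<Rightarrow> int" where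
  "arr xs i = (if 0 \<le> i \<and> i < int (length xs) then xs ! nat i else 0)"

text \<open>The label lists are concatenated in \<open>lab\<close>, and \<open>len\<close> holds their lengths; all remaining cells
  are \<open>0\<close>. The lifetime and the VIM width are not part of the input.\<close>

definition input_store :: "nat \<Rightarrow> (nat \<times> nat \<times> nat list) list \<Rightarrow> nat \<Rightarrow> int \<Rightarrow> store" where
  "input_store n es r h = (\<lambda>x i. 0)(
     ''n'' := arr [int n],
     ''root'' := arr [int r],
     ''h'' := arr [h],
     ''m'' := arr [int (length es)],
     ''src'' := arr (map (\<lambda>(u, v, ts). int u) es),
     ''dst'' := arr (map (\<lambda>(u, v, ts). int v) es),
     ''len'' := arr (map (\<lambda>(u, v, ts). int (length ts)) es),
     ''lab'' := arr (concat (map (\<lambda>(u, v, ts). map int ts) es)))"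

end

theory Submission
  imports Defs "HOL-Library.FuncSet"
begin

text \<open>One may save up defences and use them only at the moment when a vertex is threatened: if the
  vertices defended in this lazy way are, for every \<open>t\<close>, at most \<open>t\<close> in number up to timestep \<open>t\<close>,
  then defending them in the same order, one per timestep, is a strategy that saves at least as
  much. So the game is a sequence of contacts along active time-edges, each of which either burns
  or defends an untouched vertex.

  A vertex whose labels are all in the past never matters again, so its status can be forgotten
  and only the two counters kept. The vertices with a nonzero status then lie in the current bag
  (plus the root), which leaves at most \<open>4 ^ (\<omega> + 1) (n + 1)\<^sup>2\<close> states for each of the
  \<open>O(\<Lambda> n\<^sup>2)\<close> contacts. A worklist search through them spends \<open>O(n)\<close> steps on each state, and
  \<open>4 \<le> 9\<close>.\<close>

section \<open>Timed total correctness\<close>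

text \<open>The obstacle is that a strategy may defend a vertex long before its first label. Such a
  vertex lies outside the current bag, so the number of states that record real defences need not be
  bounded in terms of \<open>\<omega>\<close>. Deferring each defence to the first threat gives
  every recorded vertex except the root a past or current label, and forgetting ensures that it also
  has a current or coming one; together they place it in the bag. The root is exceptional because it
  burns without having been reached. Forgetting has a price: the counters are no longer the
  cardinalities of the status classes, so neither correctness nor the bound \<open>n\<close> on the
  counters can be read off a remembered state. Both are established for the system that never
  forgets, and the two systems are matched outcome by outcome, in both directions. A forgotten
  vertex looks like an untouched one, which is harmless because no later contact involves
  it.\<close>

definition runs :: "com \<Rightarrow> store \<Rightarrow> nat \<Rightarrow> (store \<Rightarrow> bool) \<Rightarrow> bool" where
  "runs c s k Q \<longleftrightarrow> (\<exists>T s'. exec c s T s' \<and> T \<le> k \<and> Q s')"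

fun loop_free :: "com \<Rightarrow> bool" where
  "loop_free (Seq c d) \<longleftrightarrow> loop_free c \<and> loop_free d"
| "loop_free (Cond b c d) \<longleftrightarrow> loop_free c \<and> loop_free d"
| "loop_free (While b c) \<longleftrightarrow> False"
| "loop_free c \<longleftrightarrow> True"

text \<open>Together with \<open>cost_bound\<close> this lets \<open>simp\<close> evaluate loop-free
  code symbolically. The value on \<open>While\<close> is a dummy: only programs satisfying
  \<open>loop_free\<close> are evaluated this way.\<close>

fun effect :: "com \<Rightarrow> store \<Rightarrow> store" where
  "effect (Put x a b) s = s(x := (s x)(aval a s := aval b s))"
| "effect (Seq c d) s = effect d (effect c s)"
| "effect (Cond b c d) s = (if bval b s then effect c s else effect d s)"
| "effect _ s = s"

text \<open>The branches of a conditional are added instead of compared, which keeps the bound a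
  plain sum; the loss is absorbed by the generous constants.\<close>

fun cost_bound :: "com \<Rightarrow> nat" where
  "cost_bound (Put x a b) = acost a + acost b + 1"
| "cost_bound (Seq c d) = cost_bound c + cost_bound d"
| "cost_bound (Cond b c d) = bcost b + 1 + (cost_bound c + cost_bound d)"
| "cost_bound _ = 1"

fun modified :: "com \<Rightarrow> string set" where
  "modified (Put x a b) = {x}"
| "modified (Seq c d) = modified c \<union> modified d"
| "modified (Cond b c d) = modified c \<union> modified d"
| "modified (While b c) = modified c"
| "modified Skip = {}"

lemma exec_frame: "exec c s T s' \<Longrightarrow> x \<notin> modified c \<Longrightarrow> s' x = s x"
  by (induction rule: exec.induct) auto

lemma loop_free_exec: "loop_free c \<Longrightarrow> \<exists>T\<le>cost_bound c. exec c s T (effect c s)"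
proof (induction c arbitrary: s)
  case Skip
  show ?case using exec.Skip by auto
next
  case (Put x a b)
  show ?case using exec.Put[of x a b s] by (auto intro!: exI[of _ "acost a + acost b + 1"] simp del: fun_upd_apply)
next
  case (Seq c d)
  obtain T where "T \<le> cost_bound c" "exec c s T (effect c s)" using Seq by auto
  moreover obtain U where "U \<le> cost_bound d" "exec d (effect c s) U (effect d (effect c s))"
    using Seq by auto
  ultimately show ?case by (auto intro!: exI[of _ "T + U"] exec.Seq)
next
  case (Cond b c d)
  obtain T where T: "T \<le> cost_bound c" "exec c s T (effect c s)" using Cond by auto
  obtain U where U: "U \<le> cost_bound d" "exec d s U (effect d s)" using Cond by auto
  show ?case
  proof (cases "bval b s")
    case True
    then show ?thesis using T by (auto intro!: exI[of _ "bcost b + 1 + T"] dest: exec.CondTrue)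
  next
    case False
    then show ?thesis using U by (auto intro!: exI[of _ "bcost b + 1 + U"] dest: exec.CondFalse)
  qed
qed auto

lemma runs_loop_free:
  "loop_free c \<Longrightarrow> cost_bound c \<le> k \<Longrightarrow> Q (effect c s) \<Longrightarrow> runs c s k Q"
  unfolding runs_def using loop_free_exec[of c s] by (meson le_trans)

lemma runs_mono: "runs c s k Q \<Longrightarrow> k \<le> l \<Longrightarrow> (\<And>s'. Q s' \<Longrightarrow> R s') \<Longrightarrow> runs c s l R"
  unfolding runs_def by (meson le_trans)

lemma runs_Seq:
  assumes "runs c s k P" "\<And>s'. P s' \<Longrightarrow> (\<And>x. x \<notin> modified c \<Longrightarrow> s' x = s x) \<Longrightarrow> runs d s' l Q"
    and "k + l \<le> j"
  shows "runs (Seq c d) s j Q"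
proof -
  obtain T s' where T: "exec c s T s'" "T \<le> k" "P s'" using assms(1) unfolding runs_def by blast
  then have "runs d s' l Q" using assms(2) exec_frame by blast
  then obtain U s'' where "exec d s' U s''" "U \<le> l" "Q s''" unfolding runs_def by blast
  then show ?thesis using T assms(3) exec.Seq[OF T(1)] unfolding runs_def
    by (meson add_mono le_trans)
qed

lemma runs_Seq_loop_free:
  assumes "loop_free c" "runs d (effect c s) l Q" "cost_bound c + l \<le> k"
  shows "runs (Seq c d) s k Q"
  by (rule runs_Seq[OF runs_loop_free[where Q = "\<lambda>s'. s' = effect c s"]]) (use assms in auto)

lemma effect_frame: "x \<notin> modified c \<Longrightarrow> effect c s x = s x"
  by (induction c arbitrary: s) auto

lemma runs_Cond:
  assumes "bval b s \<Longrightarrow> runs c s k Q" "\<not> bval b s \<Longrightarrow> runs d s k Q" "bcost b + 1 + k \<le> l"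
  shows "runs (Cond b c d) s l Q"
proof (cases "bval b s")
  case True
  then obtain T s' where "exec c s T s'" "T \<le> k" "Q s'"
    using assms(1) unfolding runs_def by blast
  then show ?thesis using exec.CondTrue[OF True] assms(3) unfolding runs_def
    by (meson add_left_mono le_trans)
next
  case False
  then obtain T s' where "exec d s T s'" "T \<le> k" "Q s'"
    using assms(2) unfolding runs_def by blast
  then show ?thesis using exec.CondFalse[OF False] assms(3) unfolding runs_def
    by (meson add_left_mono le_trans)
qed

text \<open>The index of the invariant is a ghost iteration counter: an iteration starts only below
  \<open>N\<close>, so induction on \<open>N - i\<close> yields termination and the time bound
  together. The frame facts refer to the store on entry, so invariants need not mention arrays that
  the body never writes.\<close>

lemma runs_While:
  fixes I :: "nat \<Rightarrow> store \<Rightarrow> bool"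
  assumes init: "I 0 s0"
    and body: "\<And>i s. I i s \<Longrightarrow> (\<And>x. x \<notin> modified c \<Longrightarrow> s x = s0 x) \<Longrightarrow> bval b s \<Longrightarrow>
      i < N \<and> runs c s k (I (Suc i))"
    and post: "\<And>i s. I i s \<Longrightarrow> (\<And>x. x \<notin> modified c \<Longrightarrow> s x = s0 x) \<Longrightarrow> \<not> bval b s \<Longrightarrow> Q s"
    and bound: "N * (k + bcost b + 1) + bcost b + 1 \<le> l"
  shows "runs (While b c) s0 l Q"
proof -
  have "runs (While b c) s ((N - i) * (k + bcost b + 1) + bcost b + 1) Q"
    if "I i s" "\<And>x. x \<notin> modified c \<Longrightarrow> s x = s0 x" for i s
    using that
  proof (induction "N - i" arbitrary: i s rule: less_induct)
    case less
    show ?case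
    proof (cases "bval b s")
      case False
      then have "Q s" using post less.prems by blast
      then show ?thesis using exec.WhileFalse[OF False, of c] unfolding runs_def
        by (intro exI[of _ "bcost b + 1"] exI[of _ s]) auto
    next
      case True
      then have *: "i < N" "runs c s k (I (Suc i))" using body[OF less.prems] by auto
      then obtain T s' where T: "exec c s T s'" "T \<le> k" "I (Suc i) s'" unfolding runs_def by blast
      have "runs (While b c) s' ((N - Suc i) * (k + bcost b + 1) + bcost b + 1) Q"
        by (rule less.hyps) (use * T exec_frame[OF T(1)] less.prems in auto)
      then obtain U s'' where U: "exec (While b c) s' U s''" "Q s''"
        "U \<le> (N - Suc i) * (k + bcost b + 1) + bcost b + 1" unfolding runs_def by blast
      have "N - i = Suc (N - Suc i)" using * by auto
      then have "bcost b + 1 + T + U \<le> (N - i) * (k + bcost b + 1) + bcost b + 1"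
        using T(2) U(3) by simp
      then show ?thesis using exec.WhileTrue[OF True T(1) U(1)] U(2) unfolding runs_def by blast
    qed
  qed
  from this[of 0 s0] show ?thesis using init bound by (auto elim: runs_mono)
qed

lemma runs_init_While:
  fixes I :: "nat \<Rightarrow> store \<Rightarrow> bool"
  assumes c: "loop_free c" and init: "I 0 (effect c s0)"
    and body: "\<And>i s. I i s \<Longrightarrow> (\<And>x. x \<notin> modified (Seq c d) \<Longrightarrow> s x = s0 x) \<Longrightarrow> bval b s \<Longrightarrow>
      i < N \<and> runs d s k (I (Suc i))"
    and post: "\<And>i s. I i s \<Longrightarrow> (\<And>x. x \<notin> modified (Seq c d) \<Longrightarrow> s x = s0 x) \<Longrightarrow> \<not> bval b s \<Longrightarrow> Q s"
    and bound: "cost_bound c + (N * (k + bcost b + 1) + bcost b + 1) \<le> l"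
  shows "runs (Seq c (While b d)) s0 l Q"
proof (rule runs_Seq_loop_free[OF c runs_While bound])
  show "I 0 (effect c s0)" by (rule init)
next
  fix i s assume "I i s" "\<And>x. x \<notin> modified d \<Longrightarrow> s x = effect c s0 x" "bval b s"
  then show "i < N \<and> runs d s k (I (Suc i))" using effect_frame[of _ c s0] by (intro body) auto
next
  fix i s assume "I i s" "\<And>x. x \<notin> modified d \<Longrightarrow> s x = effect c s0 x" "\<not> bval b s"
  then show "Q s" using effect_frame[of _ c s0] by (intro post) auto
qed simp

lemma runs_init_While_loop_free:
  fixes I :: "nat \<Rightarrow> store \<Rightarrow> bool"
  assumes "loop_free c" "loop_free d" "I 0 (effect c s0)"
    and "\<And>i s. I i s \<Longrightarrow> (\<And>x. x \<notin> modified (Seq c d) \<Longrightarrow> s x = s0 x) \<Longrightarrow> bval b s \<Longrightarrow>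
      i < N \<and> I (Suc i) (effect d s)"
    and "\<And>i s. I i s \<Longrightarrow> (\<And>x. x \<notin> modified (Seq c d) \<Longrightarrow> s x = s0 x) \<Longrightarrow> \<not> bval b s \<Longrightarrow> Q s"
    and "cost_bound c + (N * (cost_bound d + bcost b + 1) + bcost b + 1) \<le> l"
  shows "runs (Seq c (While b d)) s0 l Q"
  by (rule runs_init_While[where I = I and N = N and k = "cost_bound d"])
    (use assms in \<open>auto intro!: runs_loop_free\<close>)

section \<open>A branching system for the fire\<close>

text \<open>A state \<open>(f, x, y)\<close> consists of the status of every vertex (\<open>0\<close> untouched, \<open>1\<close> burning,
  \<open>2\<close> burning since the current timestep and hence not yet spreading, \<open>3\<close> defended), the number
  \<open>x\<close> of vertices that have burnt and the number \<open>y\<close> of vertices that have been defended.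
  An instruction \<open>(a, b, t)\<close> with \<open>a \<noteq> b\<close> lets the fire try to pass from \<open>a\<close> to \<open>b\<close>;
  with \<open>a = b\<close> it ends timestep \<open>t\<close>, and only the vertices \<open>v\<close> with \<open>K t v\<close> keep their status.\<close>

type_synonym state = "(nat \<Rightarrow> nat) \<times> nat \<times> nat"

fun branches :: "(nat \<Rightarrow> nat \<Rightarrow> bool) \<Rightarrow> nat \<times> nat \<times> nat \<Rightarrow> state \<Rightarrow> state list" where
  "branches K (a, b, t) (f, x, y) =
     (if a = b then [(\<lambda>v. if K t v then (if f v = 2 then 1 else f v) else 0, x, y)]
      else if f a = 1 \<and> f b = 0 then
        (f(b := 2), x + 1, y) # (if y < t then [(f(b := 3), x, y + 1)] else [])
      else [(f, x, y)])"

fun outcomes :: "(nat \<Rightarrow> nat \<Rightarrow> bool) \<Rightarrow> (nat \<times> nat \<times> nat) list \<Rightarrow> state \<Rightarrow> state set" where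
  "outcomes K [] z = {z}"
| "outcomes K (c # cs) z = (\<Union>z'\<in>set (branches K c z). outcomes K cs z')"

lemma outcomes_append: "outcomes K (cs @ ds) z = (\<Union>z'\<in>outcomes K cs z. outcomes K ds z')"
  by (induction cs arbitrary: z) auto

text \<open>With this predicate the system is the actual game, and it is the one compared with
  strategies. The search runs with \<open>later\<close> in its place.\<close>

abbreviation remember_all :: "nat \<Rightarrow> nat \<Rightarrow> bool" where
  "remember_all \<equiv> \<lambda>_ _. True"

text \<open>A function vanishing outside \<open>A\<close> is determined by its restriction to
  \<open>A\<close>, one of \<open>k ^ card A\<close> maps into \<open>{..<k}\<close>.\<close>

lemma card_bounded_functions:
  assumes "finite A"
  shows "finite {f :: nat \<Rightarrow> nat. (\<forall>v. f v < k) \<and> (\<forall>v. f v \<noteq> 0 \<longrightarrow> v \<in> A)} \<and>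
    card {f :: nat \<Rightarrow> nat. (\<forall>v. f v < k) \<and> (\<forall>v. f v \<noteq> 0 \<longrightarrow> v \<in> A)} \<le> k ^ card A"
proof -
  let ?S = "{f :: nat \<Rightarrow> nat. (\<forall>v. f v < k) \<and> (\<forall>v. f v \<noteq> 0 \<longrightarrow> v \<in> A)}"
  have inj: "inj_on (\<lambda>f. restrict f A) ?S"
  proof (rule inj_onI, rule ext)
    fix f g v assume fg: "f \<in> ?S" "g \<in> ?S" "restrict f A = restrict g A"
    show "f v = g v"
    proof (cases "v \<in> A")
      case True
      then show ?thesis using fg(3) by (metis restrict_apply')
    next
      case False
      then have "f v = 0" "g v = 0" using fg(1,2) by blast+
      then show ?thesis by simp
    qed
  qed
  have sub: "(\<lambda>f. restrict f A) ` ?S \<subseteq> A \<rightarrow>\<^sub>E {..<k}" by auto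
  have fin: "finite (A \<rightarrow>\<^sub>E {..<k})" using assms by (simp add: finite_PiE)
  have card: "card (A \<rightarrow>\<^sub>E {..<k}) = k ^ card A" using assms by (simp add: card_PiE)
  show ?thesis
    using finite_imageD[OF finite_subset[OF sub fin] inj] card_mono[OF fin sub] card_image[OF inj] card
    by simp
qed

section \<open>Active time-edges, the schedule of contacts and the bags\<close>

locale firefighter_input =
  fixes G :: "nat tgraph" and n r :: nat and es :: "(nat \<times> nat \<times> nat list) list"
  assumes temporal: "temporal_graph G" and verts: "verts G = {..<n}"
    and root: "r \<in> verts G" and enum: "enumerates es G"
begin

definition src :: "nat \<Rightarrow> nat" where "src e = fst (es ! e)"
definition dst :: "nat \<Rightarrow> nat" where "dst e = fst (snd (es ! e))"
definition labs :: "nat \<Rightarrow> nat list" where "labs e = snd (snd (es ! e))"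

definition active :: "nat \<Rightarrow> nat \<Rightarrow> nat \<Rightarrow> bool" where
  "active a b t \<longleftrightarrow> {a, b} \<in> edges G \<and> t \<in> labels G {a, b}"

text \<open>Strict, since it is asked once timestep \<open>t\<close> is over. Its counterpart
  \<open>begun\<close> is not strict and also accepts the label 0, in line with the minimum in
  \<open>vim_bag\<close>.\<close>

definition later :: "nat \<Rightarrow> nat \<Rightarrow> bool" where
  "later t v \<longleftrightarrow> (\<exists>u t'. active v u t' \<and> t < t')"

definition begun :: "nat \<Rightarrow> nat \<Rightarrow> bool" where
  "begun t v \<longleftrightarrow> (\<exists>u t'. active v u t' \<and> t' \<le> t)"

definition contacts :: "nat \<Rightarrow> nat \<Rightarrow> (nat \<times> nat \<times> nat) list" where
  "contacts t e = (if t \<in> set (labs e) then [(src e, dst e, t), (dst e, src e, t)] else [])"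

definition sweep :: "nat \<Rightarrow> (nat \<times> nat \<times> nat) list" where
  "sweep t = concat (map (contacts t) [0..<length es])"

text \<open>\<open>(0, 0, t)\<close> is the end marker of timestep \<open>t\<close>; the endpoints
  of a contact always differ, so the two cannot be confused. Timesteps start at 1, hence the label 0
  never produces a contact.\<close>

definition schedule :: "nat \<Rightarrow> (nat \<times> nat \<times> nat) list" where
  "schedule T = concat (map (\<lambda>t. sweep t @ [(0, 0, t)]) [1..<Suc T])"

definition start :: state where
  "start = ((\<lambda>_. 0)(r := 1), 1, 0)"

lemma schedule_0: "schedule 0 = []" and
  schedule_Suc: "schedule (Suc T) = schedule T @ sweep (Suc T) @ [(0, 0, Suc T)]"
  by (auto simp: schedule_def)

lemma root_less: "r < n" using root verts by auto

lemma active_sym: "active a b t \<longleftrightarrow> active b a t"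
  by (simp add: active_def insert_commute)

lemma edge_ends:
  assumes "{a, b} \<in> edges G" shows "a < n" "b < n" "a \<noteq> b"
proof -
  have "\<forall>E\<in>edges G. \<exists>u\<in>verts G. \<exists>v\<in>verts G. u \<noteq> v \<and> E = {u, v}"
    using temporal unfolding temporal_graph_def by (elim conjE)
  from this[rule_format, OF assms] obtain u v where
    "u \<in> verts G" "v \<in> verts G" "u \<noteq> v" "{a, b} = {u, v}" by (elim bexE conjE)
  then have "a \<in> verts G \<and> b \<in> verts G \<and> a \<noteq> b" unfolding doubleton_eq_iff by blast
  then show "a < n" "b < n" "a \<noteq> b" using verts by auto
qed

lemma activeD: assumes "active a b t" shows "a < n" "b < n" "a \<noteq> b" "t \<le> lifetime G"
proof -
  from assms have e: "{a, b} \<in> edges G" "t \<in> labels G {a, b}" by (auto simp: active_def)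
  then show "a < n" "b < n" "a \<noteq> b" by (auto dest: edge_ends)
  have "edges G \<subseteq> Pow (verts G)" using temporal unfolding temporal_graph_def by auto
  then have "finite (edges G)" by (rule finite_subset) (use temporal in \<open>auto simp: temporal_graph_def\<close>)
  then have "finite (\<Union>e\<in>edges G. labels G e)" using temporal by (auto simp: temporal_graph_def)
  then show "t \<le> lifetime G" using e unfolding lifetime_def by (intro Max_ge) auto
qed

lemma labels_enum:
  assumes "e < length es"
  shows "set (labs e) = labels G {src e, dst e}" "distinct (labs e)" "{src e, dst e} \<in> edges G"
proof -
  have mem: "(src e, dst e, labs e) \<in> set es"
    using assms by (simp add: src_def dst_def labs_def)
  then show "set (labs e) = labels G {src e, dst e}" "distinct (labs e)"
    using enum unfolding enumerates_def by fast+
  have "(\<lambda>(u, v, ts). {u, v}) ` set es = edges G" using enum unfolding enumerates_def by blast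
  then show "{src e, dst e} \<in> edges G" using imageI[OF mem, of "\<lambda>(u, v, ts). {u, v}"] by simp
qed

lemma edge_index:
  assumes "E \<in> edges G" obtains e where "e < length es" "E = {src e, dst e}"
proof -
  have "E \<in> (\<lambda>(u, v, ts). {u, v}) ` set es" using enum assms unfolding enumerates_def by simp
  then obtain x where x: "x \<in> set es" "E = (\<lambda>(u, v, ts). {u, v}) x" by blast
  then obtain e where e: "e < length es" "es ! e = x" by (auto simp: in_set_conv_nth)
  show ?thesis by (rule that[OF e(1)]) (use x e in \<open>auto simp: src_def dst_def split: prod.splits\<close>)
qed

lemma active_iff:
  "active a b t \<longleftrightarrow> (\<exists>e<length es. {a, b} = {src e, dst e} \<and> t \<in> set (labs e))"
proof
  assume "active a b t"
  then have *: "{a, b} \<in> edges G" "t \<in> labels G {a, b}" by (auto simp: active_def)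
  then obtain e where "e < length es" "{a, b} = {src e, dst e}" by (rule_tac edge_index)
  then show "\<exists>e<length es. {a, b} = {src e, dst e} \<and> t \<in> set (labs e)"
    using * labels_enum(1) by auto
next
  assume "\<exists>e<length es. {a, b} = {src e, dst e} \<and> t \<in> set (labs e)"
  then show "active a b t" unfolding active_def using labels_enum by auto
qed

lemma src_dst_less:
  assumes "e < length es" shows "src e < n" "dst e < n" "src e \<noteq> dst e"
  using edge_ends labels_enum(3)[OF assms] by blast+

lemma sweep_iff: "(a, b, t') \<in> set (sweep t) \<longleftrightarrow> t' = t \<and> active a b t"
  unfolding sweep_def active_iff contacts_def
  by (auto simp: doubleton_eq_iff split: if_splits)

text \<open>An index is determined by its ordered pair of endpoints, since the enumeration lists no
  edge twice.\<close>

lemma number_of_edges: "length es \<le> n ^ 2"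
proof -
  have d: "distinct (map (\<lambda>(u, v, ts). {u, v}) es)" using enum unfolding enumerates_def by simp
  have "inj_on (\<lambda>e. (src e, dst e)) {..<length es}"
  proof (rule inj_onI)
    fix e e' assume "e \<in> {..<length es}" "e' \<in> {..<length es}" "(src e, dst e) = (src e', dst e')"
    moreover from this have "map (\<lambda>(u, v, ts). {u, v}) es ! e = map (\<lambda>(u, v, ts). {u, v}) es ! e'"
      by (auto simp: src_def dst_def split: prod.splits)
    ultimately show "e = e'" using d nth_eq_iff_index_eq by fastforce
  qed
  moreover have "(\<lambda>e. (src e, dst e)) ` {..<length es} \<subseteq> {..<n} \<times> {..<n}"
    using src_dst_less by auto
  ultimately have "card {..<length es} \<le> card ({..<n} \<times> {..<n})"
    by (metis card_inj_on_le finite_SigmaI finite_lessThan)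
  then show ?thesis by (simp add: power2_eq_square)
qed

lemma length_labs: "e < length es \<Longrightarrow> length (labs e) \<le> lifetime G + 1"
proof -
  assume e: "e < length es"
  have "set (labs e) \<subseteq> {..lifetime G}"
  proof
    fix t assume "t \<in> set (labs e)"
    then have "active (src e) (dst e) t" using e unfolding active_iff by blast
    then show "t \<in> {..lifetime G}" using activeD by auto
  qed
  then have "card (set (labs e)) \<le> card {..lifetime G}" by (intro card_mono) auto
  then show ?thesis using labels_enum(2)[OF e] by (simp add: distinct_card)
qed

lemma length_schedule: "length (schedule T) \<le> T * (2 * length es + 1)"
proof -
  have "length (contacts t e) \<le> 2" for t e by (simp add: contacts_def)
  then have "length (sweep t) \<le> 2 * length es" for t
    unfolding sweep_def length_concat map_map
    using sum_list_mono[of "[0..<length es]" "length \<circ> contacts t" "\<lambda>_. 2"]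
    by (simp add: sum_list_triv comp_def mult.commute)
  then show ?thesis
    by (induction T) (auto simp: schedule_0 schedule_Suc intro: add_mono le_trans)
qed

text \<open>A label witnessing \<open>later t' v\<close> is at least \<open>Suc t'\<close>, hence at
  least \<open>t\<close>. This off-by-one lets one bag cover a whole timestep: the lemma is applied
  with \<open>t = Suc t'\<close> while timestep \<open>Suc t'\<close> is being processed.\<close>

lemma vim_bagI: assumes "begun t v" "later t' v" "t \<le> Suc t'" shows "v \<in> vim_bag G t"
proof -
  obtain u k where u: "active v u k" "k \<le> t" using assms by (auto simp: begun_def)
  obtain w l where w: "active v w l" "t \<le> l" using assms by (auto simp: later_def)
  have fin: "finite (labels G E)" if "E \<in> edges G" for E
    using that temporal by (auto simp: temporal_graph_def)
  have "Min (labels G {v, u}) \<le> t" "t \<le> Max (labels G {v, w})"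
    using u w fin Min_le[of "labels G {v, u}" k] Max_ge[of "labels G {v, w}" l]
    unfolding active_def by fastforce+
  then show ?thesis using u w activeD(1)[OF u(1)] verts unfolding vim_bag_def active_def by auto
qed

lemma card_vim_bag: "1 \<le> t \<Longrightarrow> t \<le> lifetime G \<Longrightarrow> card (vim_bag G t) \<le> vim_width G"
  unfolding vim_width_def by (intro Max_ge) auto

subsection \<open>Forgetting vertices without later contacts\<close>

fun agree :: "nat \<Rightarrow> state \<Rightarrow> state \<Rightarrow> bool" where
  "agree t (f, x, y) (f', x', y') \<longleftrightarrow> x = x' \<and> y = y' \<and> (\<forall>v. later t v \<longrightarrow> f v = f' v)"

text \<open>Both endpoints of a contact at \<open>Suc t\<close> have a label beyond
  \<open>t\<close>, so the two states agree on the statuses that the guard tests, and their branches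
  correspond one to one.\<close>

lemma agree_contact:
  assumes "agree t z z'" "active a b (Suc t)"
  shows "list_all2 (agree t) (branches later (a, b, Suc t) z) (branches remember_all (a, b, Suc t) z')"
proof -
  have "later t a" "later t b" using assms(2) active_sym unfolding later_def by blast+
  then show ?thesis using assms activeD(3)[OF assms(2)] by (cases z; cases z') auto
qed

text \<open>Agreement is demanded on fewer and fewer vertices, because
  \<open>later (Suc t) v\<close> implies \<open>later t v\<close>; the vertices erased here are no
  longer among them.\<close>

lemma agree_finish:
  assumes "agree t z z'"
  shows "list_all2 (agree (Suc t)) (branches later (0, 0, Suc t) z)
    (branches remember_all (0, 0, Suc t) z')"
proof -
  have "later (Suc t) v \<Longrightarrow> later t v" for v unfolding later_def by (meson Suc_lessD)
  then show ?thesis using assms by (cases z; cases z') auto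
qed

lemma agree_contacts:
  assumes "agree t z z'" "\<forall>(a, b, t')\<in>set cs. t' = Suc t \<and> active a b (Suc t)"
  shows "rel_set (agree t) (outcomes later cs z) (outcomes remember_all cs z')"
  using assms
proof (induction cs arbitrary: z z')
  case Nil
  then show ?case by (auto simp: rel_set_def)
next
  case (Cons c cs)
  obtain a b where c: "c = (a, b, Suc t)" "active a b (Suc t)" using Cons.prems by auto
  have 1: "rel_set (agree t) (set (branches later c z)) (set (branches remember_all c z'))"
    using list.set_transfer[THEN rel_funD, OF agree_contact[OF Cons.prems(1) c(2)]] c(1) by simp
  have 2: "rel_set (agree t) (outcomes later cs w) (outcomes remember_all cs w')" if "agree t w w'" for w w'
    using that Cons by auto
  show ?case using 1 2 unfolding rel_set_def by (simp del: branches.simps) meson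
qed

lemma agree_finish_set:
  assumes "rel_set (agree t) A B"
  shows "rel_set (agree (Suc t)) (\<Union>z\<in>A. outcomes later [(0, 0, Suc t)] z)
    (\<Union>z\<in>B. outcomes remember_all [(0, 0, Suc t)] z)"
proof -
  have "rel_set (agree (Suc t)) (outcomes later [(0, 0, Suc t)] z) (outcomes remember_all [(0, 0, Suc t)] z')"
    if "agree t z z'" for z z'
    using list.set_transfer[THEN rel_funD, OF agree_finish[OF that]] by (simp del: branches.simps)
  then show ?thesis using assms unfolding rel_set_def by (simp del: branches.simps outcomes.simps) meson
qed

lemma agree_contacts_set:
  assumes "rel_set (agree t) A B" "\<forall>(a, b, t')\<in>set cs. t' = Suc t \<and> active a b (Suc t)"
  shows "rel_set (agree t) (\<Union>z\<in>A. outcomes later cs z) (\<Union>z\<in>B. outcomes remember_all cs z)"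
  using assms(1) agree_contacts[OF _ assms(2)] unfolding rel_set_def by simp meson

lemma agree_schedule:
  "rel_set (agree T) (outcomes later (schedule T) start) (outcomes remember_all (schedule T) start)"
proof (induction T)
  case 0
  show ?case by (auto simp: rel_set_def schedule_0 start_def)
next
  case (Suc T)
  have *: "outcomes K (schedule (Suc T)) start =
      (\<Union>z\<in>(\<Union>z\<in>outcomes K (schedule T) start. outcomes K (sweep (Suc T)) z).
        outcomes K [(0, 0, Suc T)] z)" for K
    by (simp add: schedule_Suc outcomes_append del: branches.simps outcomes.simps)
  show ?case unfolding *
    by (intro agree_finish_set agree_contacts_set Suc) (auto simp: sweep_iff)
qed

text \<open>The search also visits states in the middle of a timestep, so the matching is needed for
  prefixes that end between two markers.\<close>

lemma agree_prefix:
  assumes "\<forall>(a, b, t')\<in>set cs. t' = Suc T \<and> active a b (Suc T)"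
  shows "rel_set (agree T) (outcomes later (schedule T @ cs) start)
    (outcomes remember_all (schedule T @ cs) start)"
  unfolding outcomes_append by (rule agree_contacts_set[OF agree_schedule assms])

subsection \<open>The number of remembered states\<close>

text \<open>The counters are tied to the statuses. The forgetting system violates this as soon as it
  erases a nonzero status, which is why the invariant is only propagated under
  \<open>remember_all\<close>.\<close>

fun counted :: "state \<Rightarrow> bool" where
  "counted (f, x, y) \<longleftrightarrow> (\<forall>v. f v \<noteq> 0 \<longrightarrow> v < n) \<and> (\<forall>v. f v < 4) \<and>
     x = card {v. f v = 1 \<or> f v = 2} \<and> y = card {v. f v = 3}"

lemma counted_finite:
  assumes "counted (f, x, y)" "c \<noteq> 0" shows "finite {v. f v = c}"
proof (rule finite_subset)
  show "{v. f v = c} \<subseteq> {..<n}" using assms by auto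
qed simp

lemma counted_branches:
  assumes "counted z" "b < n" "z' \<in> set (branches remember_all (a, b, t) z)"
  shows "counted z'"
proof -
  obtain f x y where z: "z = (f, x, y)" by (cases z) auto
  have fin: "finite {v. f v = 1 \<or> f v = 2}" "finite {v. f v = 3}"
    by (rule finite_subset[of _ "{..<n}"]; use assms(1) z in force)+
  consider "a = b" "z' = (\<lambda>v. if f v = 2 then 1 else f v, x, y)"
    | "z' = z" | "a \<noteq> b" "f b = 0" "z' = (f(b := 2), x + 1, y)"
    | "a \<noteq> b" "f b = 0" "z' = (f(b := 3), x, y + 1)"
    using assms(3) z by (auto split: if_splits)
  then show ?thesis
  proof cases
    case 1
    have "{v. (f v = 2 \<or> (f v \<noteq> 2 \<and> f v = 1))} = {v. f v = 1 \<or> f v = 2}"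
      "{v. (f v \<noteq> 2 \<and> f v = 3)} = {v. f v = 3}" by auto
    then show ?thesis using 1 assms(1) z by (auto intro!: arg_cong[of _ _ card])
  next
    case 2
    then show ?thesis using assms(1) by simp
  next
    case 3
    have "{v. (f(b := 2)) v = 1 \<or> (f(b := 2)) v = 2} = insert b {v. f v = 1 \<or> f v = 2}"
      "{v. (f(b := 2)) v = 3} = {v. f v = 3}" using 3 by auto
    then show ?thesis using 3 assms(1,2) fin z by auto
  next
    case 4
    have "{v. (f(b := 3)) v = 3} = insert b {v. f v = 3}"
      "{v. (f(b := 3)) v = 1 \<or> (f(b := 3)) v = 2} = {v. f v = 1 \<or> f v = 2}" using 4 by auto
    then show ?thesis using 4 assms(1,2) fin z by auto
  qed
qed

lemma counted_outcomes:
  "counted z \<Longrightarrow> \<forall>(a, b, t)\<in>set cs. b < n \<Longrightarrow> z' \<in> outcomes remember_all cs z \<Longrightarrow> counted z'"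
proof (induction cs arbitrary: z)
  case (Cons c cs)
  obtain a b t where c: "c = (a, b, t)" by (cases c)
  obtain w where w: "w \<in> set (branches remember_all c z)" "z' \<in> outcomes remember_all cs w"
    using Cons.prems by auto
  have "counted w" using counted_branches[of z b w a t] Cons.prems w c by auto
  then show ?case using Cons w by auto
qed auto

lemma counted_start: "counted start"
  using root_less by (auto simp: start_def)

lemma schedule_less: "(a, b, t) \<in> set (schedule T) \<Longrightarrow> a < n \<and> b < n \<and> 1 \<le> t \<and> t \<le> T"
  using root_less activeD(1,2) by (induction T) (auto simp: schedule_0 schedule_Suc sweep_iff)

lemma counted_card: assumes "counted (f, x, y)" shows "x \<le> n" "y \<le> n"
proof -
  have "{v. f v = 1 \<or> f v = 2} \<subseteq> {..<n}" "{v. f v = 3} \<subseteq> {..<n}" using assms by force+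
  then show "x \<le> n" "y \<le> n" using assms
    by (metis card_lessThan card_mono counted.simps finite_lessThan)+
qed

text \<open>Two indices are needed because in the middle of timestep \<open>Suc t\<close> vertices
  may have been touched through the label \<open>Suc t\<close>, although nothing has been forgotten
  since the end of \<open>t\<close>. The root burns at the start without any past label, hence its
  own disjunct.\<close>

fun remembered :: "nat \<Rightarrow> nat \<Rightarrow> state \<Rightarrow> bool" where
  "remembered t t' (f, x, y) \<longleftrightarrow> (\<forall>v. f v < 4) \<and> (\<forall>v. f v \<noteq> 0 \<longrightarrow> v < n) \<and>
     (\<forall>v. f v \<noteq> 0 \<longrightarrow> v = r \<or> later t v \<and> begun t' v)"

lemma remembered_contacts:
  assumes "remembered t (Suc t) z" "\<forall>(a, b, t')\<in>set cs. t' = Suc t \<and> active a b (Suc t)"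
    "z' \<in> outcomes later cs z"
  shows "remembered t (Suc t) z'"
  using assms
proof (induction cs arbitrary: z)
  case (Cons c cs)
  obtain a b where c: "c = (a, b, Suc t)" "active a b (Suc t)" using Cons.prems by auto
  have b: "later t b" "begun (Suc t) b" "b < n" using c(2) active_sym activeD(2)
    unfolding later_def begun_def by blast+
  obtain w where w: "w \<in> set (branches later c z)" "z' \<in> outcomes later cs w"
    using Cons.prems by auto
  have "remembered t (Suc t) w"
    using w(1) Cons.prems(1) b activeD(3)[OF c(2)] c(1) by (cases z) (auto split: if_splits)
  then show ?case using Cons w by auto
qed auto

lemma remembered_begun: "remembered t t' z \<Longrightarrow> t' \<le> t'' \<Longrightarrow> remembered t t'' z"
proof -
  assume "t' \<le> t''"
  then have "begun t' v \<Longrightarrow> begun t'' v" for v unfolding begun_def by (meson le_trans)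
  then show "remembered t t' z \<Longrightarrow> remembered t t'' z" by (cases z) auto
qed

text \<open>The marker ending timestep \<open>Suc T\<close> erases every status without a label
  beyond \<open>Suc T\<close>, which moves the first index up to the second.\<close>

lemma remembered_schedule: "z \<in> outcomes later (schedule T) start \<Longrightarrow> remembered T T z"
proof (induction T arbitrary: z)
  case 0
  then show ?case using root_less by (auto simp: schedule_0 start_def)
next
  case (Suc T)
  then obtain w w' where w: "w \<in> outcomes later (schedule T) start"
    "w' \<in> outcomes later (sweep (Suc T)) w" "z \<in> set (branches later (0, 0, Suc T) w')"
    unfolding schedule_Suc outcomes_append by auto
  have "remembered T (Suc T) w'"
    by (rule remembered_contacts[OF _ _ w(2)])
      (use Suc.IH[OF w(1)] in \<open>auto simp: sweep_iff intro: remembered_begun\<close>)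
  then show ?case using w(3) by (cases w') (force split: if_splits)
qed

lemma remembered_prefix:
  assumes "\<forall>(a, b, t')\<in>set cs. t' = Suc T \<and> active a b (Suc T)"
    "z \<in> outcomes later (schedule T @ cs) start"
  shows "remembered T (Suc T) z"
  using assms remembered_contacts[OF remembered_begun[OF remembered_schedule] assms(1)]
  unfolding outcomes_append by fastforce

text \<open>A proper prefix stops before the end marker of some timestep \<open>Suc T\<close>, so
  what follows the last complete timestep consists of contacts of \<open>Suc T\<close>
  alone.\<close>

lemma schedule_prefix:
  assumes "k < length (schedule L)"
  obtains T cs where "T < L" "take k (schedule L) = schedule T @ cs"
    "\<forall>(a, b, t')\<in>set cs. t' = Suc T \<and> active a b (Suc T)"
  using assms
proof (induction L arbitrary: thesis)
  case 0
  then show ?case by (simp add: schedule_0)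
next
  case (Suc L)
  show ?case
  proof (cases "k < length (schedule L)")
    case True
    from Suc.IH[OF _ True] obtain T cs where "T < L" "take k (schedule L) = schedule T @ cs"
      "\<forall>(a, b, t')\<in>set cs. t' = Suc T \<and> active a b (Suc T)" by blast
    then show ?thesis using True by (intro Suc.prems(1)[of T cs]) (auto simp: schedule_Suc)
  next
    case False
    let ?cs = "take (k - length (schedule L)) (sweep (Suc L))"
    have "take k (schedule (Suc L)) = schedule L @ ?cs"
      using False Suc.prems(2) by (auto simp: schedule_Suc)
    moreover have "\<forall>(a, b, t')\<in>set ?cs. t' = Suc L \<and> active a b (Suc L)"
      using sweep_iff by (auto dest: in_set_takeD)
    ultimately show ?thesis by (intro Suc.prems(1)) auto
  qed
qed

section \<open>State sets of the search and their cardinality\<close>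

definition reached :: "nat \<Rightarrow> state set" where
  "reached k = outcomes later (take k (schedule (lifetime G))) start"

lemma reached_0: "reached 0 = {start}"
  by (simp add: reached_def)

lemma reached_Suc:
  "k < length (schedule (lifetime G)) \<Longrightarrow>
    reached (Suc k) = (\<Union>z\<in>reached k. set (branches later (schedule (lifetime G) ! k) z))"
  by (auto simp: reached_def take_Suc_conv_app_nth outcomes_append)

text \<open>Forgetting leaves the counters alone: a matching state of the remembering system has the
  same \<open>x\<close> and \<open>y\<close>, and there they are cardinalities of sets of
  vertices.\<close>

lemma reached_counts: assumes "(f, x, y) \<in> reached k" shows "x \<le> n" "y \<le> n"
proof -
  let ?S = "take k (schedule (lifetime G))"
  have "\<exists>T. rel_set (agree T) (outcomes later ?S start) (outcomes remember_all ?S start)"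
  proof (cases "k < length (schedule (lifetime G))")
    case True
    then show ?thesis using agree_prefix by (metis schedule_prefix)
  next
    case False
    then show ?thesis using agree_schedule by (metis take_all not_less)
  qed
  then obtain f' where "(f', x, y) \<in> outcomes remember_all ?S start"
    using assms unfolding reached_def rel_set_def by fastforce
  then have "counted (f', x, y)"
    by (rule counted_outcomes[OF counted_start, rotated]) (auto dest!: in_set_takeD schedule_less)
  then show "x \<le> n" "y \<le> n" by (rule counted_card)+
qed

lemma reached_statuses:
  assumes "(f, x, y) \<in> reached k" shows "f v < 4" "f v \<noteq> 0 \<Longrightarrow> v < n"
proof -
  have "\<exists>t t'. remembered t t' (f, x, y)"
  proof (cases "k < length (schedule (lifetime G))")
    case True
    then show ?thesis using remembered_prefix assms unfolding reached_def by (metis schedule_prefix)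
  next
    case False
    then show ?thesis using remembered_schedule assms unfolding reached_def by (metis take_all not_less)
  qed
  then show "f v < 4" "f v \<noteq> 0 \<Longrightarrow> v < n" by auto
qed

text \<open>Inside timestep \<open>Suc T\<close> the set is the bag of \<open>Suc T\<close> with the
  root added. Once the schedule is exhausted, no label exceeds the lifetime and only the root can be
  left.\<close>

lemma reached_support:
  "\<exists>A. finite A \<and> card A \<le> vim_width G + 1 \<and> (\<forall>f x y. (f, x, y) \<in> reached k \<longrightarrow> (\<forall>v. f v \<noteq> 0 \<longrightarrow> v \<in> A))"
proof (cases "k < length (schedule (lifetime G))")
  case True
  then obtain T cs where T: "T < lifetime G" "take k (schedule (lifetime G)) = schedule T @ cs"
      "\<forall>(a, b, t')\<in>set cs. t' = Suc T \<and> active a b (Suc T)" by (rule schedule_prefix)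
  have fin: "finite (vim_bag G (Suc T))" unfolding vim_bag_def using verts by auto
  have "card (insert r (vim_bag G (Suc T))) \<le> Suc (card (vim_bag G (Suc T)))" by (rule card_insert_le_m1) simp_all
  also have "\<dots> \<le> vim_width G + 1" using card_vim_bag[of "Suc T"] T by simp
  finally have "card (insert r (vim_bag G (Suc T))) \<le> vim_width G + 1" .
  moreover have "v \<in> insert r (vim_bag G (Suc T))" if "(f, x, y) \<in> reached k" "f v \<noteq> 0" for f x y v
    using remembered_prefix[OF T(3), of "(f, x, y)"] that T(2) vim_bagI[of "Suc T" v T]
    unfolding reached_def by auto
  ultimately show ?thesis using fin by (intro exI[of _ "insert r (vim_bag G (Suc T))"]) blast
next
  case False
  have "\<not> later (lifetime G) v" for v unfolding later_def using activeD(4) by (meson not_less)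
  then show ?thesis using False remembered_schedule[of _ "lifetime G"]
    by (intro exI[of _ "{r}"]) (fastforce simp: reached_def)
qed

lemma card_reached: "finite (reached k)" "card (reached k) \<le> 4 ^ (vim_width G + 1) * (n + 1) ^ 2"
proof -
  obtain A where A: "finite A" "card A \<le> vim_width G + 1"
    "\<forall>f x y. (f, x, y) \<in> reached k \<longrightarrow> (\<forall>v. f v \<noteq> 0 \<longrightarrow> v \<in> A)" using reached_support[of k] by (elim exE conjE)
  let ?F = "{f :: nat \<Rightarrow> nat. (\<forall>v. f v < 4) \<and> (\<forall>v. f v \<noteq> 0 \<longrightarrow> v \<in> A)}"
  have F: "finite ?F" "card ?F \<le> 4 ^ (vim_width G + 1)"
    using card_bounded_functions[OF A(1), of 4] power_increasing[OF A(2), of "4 :: nat"]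
    by (auto intro: le_trans)
  have sub: "reached k \<subseteq> ?F \<times> {..n} \<times> {..n}"
  proof
    fix z assume "z \<in> reached k"
    then obtain f x y where z: "z = (f, x, y)" "(f, x, y) \<in> reached k" by (cases z) auto
    moreover from this have "\<forall>v. f v \<noteq> 0 \<longrightarrow> v \<in> A" using A(3) by blast
    ultimately show "z \<in> ?F \<times> {..n} \<times> {..n}"
      using reached_counts[of f x y k] reached_statuses(1)[of f x y k] by auto
  qed
  show "finite (reached k)" using sub F by (meson finite_SigmaI finite_atMost finite_subset)
  have "card (reached k) \<le> card (?F \<times> {..n} \<times> {..n})" using sub F by (intro card_mono) auto
  also have "\<dots> = card ?F * (n + 1) ^ 2"
    by (simp only: card_cartesian_product card_atMost power2_eq_square Suc_eq_plus1)
  also have "\<dots> \<le> 4 ^ (vim_width G + 1) * (n + 1) ^ 2" using F(2) by (rule mult_right_mono) simp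
  finally show "card (reached k) \<le> 4 ^ (vim_width G + 1) * (n + 1) ^ 2" .
qed

declare counted.simps [simp del]

subsection \<open>Strategies and branches\<close>

lemma burning_0: "burning G r \<sigma> 0 = {r}" and
  burning_Suc: "burning G r \<sigma> (Suc t) = burning G r \<sigma> t \<union>
    {v. v < n \<and> v \<notin> defended G r \<sigma> (Suc t) \<and> (\<exists>u\<in>burning G r \<sigma> t. active u v (Suc t))}" and
  defended_0: "defended G r \<sigma> 0 = {}" and
  defended_Suc: "defended G r \<sigma> (Suc t) = defended G r \<sigma> t \<union> set_option (\<sigma> (Suc t))"
  using verts by (auto simp: burning_def defended_def active_def Let_def split: prod.splits)

lemma defended_card: "finite (defended G r \<sigma> t) \<and> card (defended G r \<sigma> t) \<le> t"
proof (induction t)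
  case (Suc t)
  have "card (defended G r \<sigma> (Suc t)) \<le> card (defended G r \<sigma> t) + card (set_option (\<sigma> (Suc t)))"
    unfolding defended_Suc by (rule card_Un_le)
  also have "card (set_option (\<sigma> (Suc t))) \<le> 1" by (cases "\<sigma> (Suc t)") auto
  finally show ?case using Suc by (cases "\<sigma> (Suc t)") (auto simp: defended_Suc)
qed (simp add: defended_0)

lemma burning_mono: "t \<le> t' \<Longrightarrow> burning G r \<sigma> t \<subseteq> burning G r \<sigma> t'"
  by (rule lift_Suc_mono_le) (auto simp: burning_Suc)

lemma burning_less: "burning G r \<sigma> t \<subseteq> {..<n}"
  using root_less by (induction t) (auto simp: burning_0 burning_Suc)

text \<open>A strategy is followed lazily: a threatened vertex is defended iff the strategy has already
  defended it.\<close>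

fun tracks :: "(nat \<Rightarrow> nat option) \<Rightarrow> nat \<Rightarrow> state \<Rightarrow> bool" where
  "tracks \<sigma> t (f, x, y) \<longleftrightarrow> counted (f, x, y) \<and>
     (\<forall>v. (f v = 1 \<longrightarrow> v \<in> burning G r \<sigma> t) \<and> (f v = 2 \<longrightarrow> v \<in> burning G r \<sigma> (Suc t)) \<and>
       (f v = 3 \<longrightarrow> v \<in> defended G r \<sigma> (Suc t)))"

text \<open>Only the budget test \<open>y < Suc t\<close> could block the lazy choice. It passes
  because the vertices of status 3 together with the threatened one are all among the at most
  \<open>Suc t\<close> vertices that \<open>\<sigma>\<close> has defended so far.\<close>

lemma tracks_contacts:
  assumes "tracks \<sigma> t z" "\<forall>(a, b, t')\<in>set cs. t' = Suc t \<and> active a b (Suc t)"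
  shows "\<exists>z'\<in>outcomes remember_all cs z. tracks \<sigma> t z'"
  using assms
proof (induction cs arbitrary: z)
  case (Cons c cs)
  obtain a b where c: "c = (a, b, Suc t)" "active a b (Suc t)" using Cons.prems by auto
  obtain f x y where z: "z = (f, x, y)" by (cases z) auto
  have b: "b < n" "a \<noteq> b" using activeD c by auto
  have "\<exists>w\<in>set (branches remember_all c z). tracks \<sigma> t w"
  proof (cases "f a = 1 \<and> f b = 0")
    case False
    then show ?thesis using Cons.prems(1) b c z by auto
  next
    case True
    show ?thesis
    proof (cases "b \<in> defended G r \<sigma> (Suc t)")
      case False
      then have "b \<in> burning G r \<sigma> (Suc t)"
        using b c(2) True Cons.prems(1) z unfolding burning_Suc by auto
      moreover have "(f(b := 2), x + 1, y) \<in> set (branches remember_all c z)"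
        using True b c z by simp
      moreover from this have "counted (f(b := 2), x + 1, y)"
        using counted_branches[of z b _ a "Suc t"] Cons.prems(1) b c z by simp
      ultimately show ?thesis using Cons.prems(1) z by (intro bexI) auto
    next
      case D: True
      have "insert b {v. f v = 3} \<subseteq> defended G r \<sigma> (Suc t)" using D Cons.prems(1) z by auto
      moreover have "finite {v. f v = 3}"
        by (rule counted_finite[of f x y]) (use Cons.prems(1) z in simp_all)
      ultimately have "y + 1 \<le> Suc t"
        using defended_card[of \<sigma> "Suc t"] card_mono[of "defended G r \<sigma> (Suc t)" "insert b {v. f v = 3}"]
          True Cons.prems(1) z by (auto simp: counted.simps)
      then have "(f(b := 3), x, y + 1) \<in> set (branches remember_all c z)"
        using True b c z by simp
      moreover from this have "counted (f(b := 3), x, y + 1)"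
        using counted_branches[of z b _ a "Suc t"] Cons.prems(1) b c z by simp
      ultimately show ?thesis using Cons.prems(1) z D by (intro bexI) auto
    qed
  qed
  then obtain w where w: "w \<in> set (branches remember_all c z)" "tracks \<sigma> t w" by blast
  then obtain z' where "z' \<in> outcomes remember_all cs w" "tracks \<sigma> t z'"
    using Cons.IH[of w] Cons.prems(2) by auto
  then show ?case using w(1) by auto
qed auto

text \<open>The marker turns status 2 into 1 exactly when the index of \<open>tracks\<close>
  advances, so that burning at \<open>Suc T\<close> becomes the meaning of status 1.\<close>

lemma tracks_schedule: "\<exists>z\<in>outcomes remember_all (schedule T) start. tracks \<sigma> T z"
proof (induction T)
  case 0
  show ?case using counted_start by (auto simp: schedule_0 start_def burning_0)
next
  case (Suc T)
  then obtain z where z: "z \<in> outcomes remember_all (schedule T) start" "tracks \<sigma> T z" by blast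
  obtain z' where z': "z' \<in> outcomes remember_all (sweep (Suc T)) z" "tracks \<sigma> T z'"
    using tracks_contacts[OF z(2), of "sweep (Suc T)"] sweep_iff by blast
  obtain f x y where f: "z' = (f, x, y)" by (cases z') auto
  let ?g = "\<lambda>v. if f v = 2 then 1 else f v"
  have br: "(?g, x, y) \<in> set (branches remember_all (0, 0, Suc T) z')" using f by auto
  have "counted (?g, x, y)" by (rule counted_branches[OF _ _ br]) (use root_less z'(2) f in auto)
  moreover have "burning G r \<sigma> T \<subseteq> burning G r \<sigma> (Suc T)" by (rule burning_mono) simp
  moreover have "defended G r \<sigma> (Suc T) \<subseteq> defended G r \<sigma> (Suc (Suc T))"
    by (simp add: defended_Suc[of _ "Suc T"])
  ultimately have "tracks \<sigma> (Suc T) (?g, x, y)" using z'(2) f by auto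
  moreover have "(?g, x, y) \<in> outcomes remember_all (schedule (Suc T)) start"
    unfolding schedule_Suc outcomes_append using z z' br by auto
  ultimately show ?case by blast
qed

text \<open>A status is set at most once within a timestep, so the order of the contacts does not
  hurt: a vertex burning at the beginning still has status 1 when its contact comes, and the target
  ends up touched. Defences are only bought while \<open>y < t\<close>, hence the maximum.\<close>

lemma contacts_effect:
  assumes "(f', x', y') \<in> outcomes remember_all cs (f, x, y)"
    "\<forall>(a, b, t')\<in>set cs. t' = t \<and> a \<noteq> b"
  shows "(\<forall>v. f v \<noteq> 0 \<longrightarrow> f' v = f v) \<and> (\<forall>a b t'. (a, b, t') \<in> set cs \<longrightarrow> f a = 1 \<longrightarrow> f' b \<noteq> 0) \<and>
    y' \<le> max y t"
  using assms
proof (induction cs arbitrary: f x y)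
  case (Cons c cs)
  obtain a b where c: "c = (a, b, t)" "a \<noteq> b" using Cons.prems by auto
  obtain g u w where g: "(g, u, w) \<in> set (branches remember_all c (f, x, y))"
    "(f', x', y') \<in> outcomes remember_all cs (g, u, w)" using Cons.prems(1) by auto
  have IH: "(\<forall>v. g v \<noteq> 0 \<longrightarrow> f' v = g v) \<and>
    (\<forall>a b t'. (a, b, t') \<in> set cs \<longrightarrow> g a = 1 \<longrightarrow> f' b \<noteq> 0) \<and> y' \<le> max w t"
    using Cons.IH[OF g(2)] Cons.prems(2) by simp
  have *: "(\<forall>v. f v \<noteq> 0 \<longrightarrow> g v = f v) \<and> (f a = 1 \<longrightarrow> g b \<noteq> 0) \<and> w \<le> max y t"
    using g(1) c by (auto split: if_splits)
  have "f' e \<noteq> 0" if "(d, e, t') \<in> set (c # cs)" "f d = 1" for d e t'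
  proof (cases "(d, e, t') \<in> set cs")
    case True
    moreover have "g d = 1" using * that(2) by simp
    ultimately show ?thesis using IH by blast
  next
    case False
    then have "g e \<noteq> 0" using that * c by auto
    then show ?thesis using IH by auto
  qed
  moreover have "\<forall>v. f v \<noteq> 0 \<longrightarrow> f' v = f v" using * IH by metis
  ultimately show ?case using * IH by (auto simp: max_def split: if_splits)
qed auto

definition enact :: "nat list \<Rightarrow> nat \<Rightarrow> nat option" where
  "enact vs t = (if 1 \<le> t \<and> t \<le> length vs then Some (vs ! (t - 1)) else None)"

lemma defended_enact: "defended G r (enact vs) t = set (take t vs)"
proof (induction t)
  case (Suc t)
  then show ?case by (cases "t < length vs") (auto simp: defended_Suc enact_def take_Suc_conv_app_nth)
qed (simp add: defended_0)

text \<open>The reserve of unused defences is spent in advance: the vertices defended in a branch are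
  defended in the order in which the branch defends them, but one in every timestep. The
  continuation \<open>ws\<close> keeps the strategy open for the later timesteps of the branch.\<close>

lemma enact_branch:
  assumes "(f, x, y) \<in> outcomes remember_all (schedule T) start"
  shows "counted (f, x, y) \<and> (\<forall>v. f v \<noteq> 2) \<and>
    (\<exists>vs. distinct vs \<and> set vs = {v. f v = 3} \<and> length vs \<le> T \<and>
      (\<forall>ws. burning G r (enact (vs @ ws)) T \<subseteq> {v. f v = 1}))"
  using assms
proof (induction T arbitrary: f x y)
  case 0
  then show ?case using counted_start by (auto simp: schedule_0 start_def burning_0 counted.simps)
next
  case (Suc T)
  then obtain f0 x0 y0 f1 where
    0: "(f0, x0, y0) \<in> outcomes remember_all (schedule T) start" and
    1: "(f1, x, y) \<in> outcomes remember_all (sweep (Suc T)) (f0, x0, y0)" and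
    f: "f = (\<lambda>v. if f1 v = 2 then 1 else f1 v)"
    unfolding schedule_Suc outcomes_append by auto
  obtain vs where IH: "counted (f0, x0, y0)" "\<And>v. f0 v \<noteq> 2" "distinct vs" "set vs = {v. f0 v = 3}"
    "length vs \<le> T" "\<And>ws. burning G r (enact (vs @ ws)) T \<subseteq> {v. f0 v = 1}"
    using Suc.IH[OF 0] by blast
  have eff: "(\<forall>v. f0 v \<noteq> 0 \<longrightarrow> f1 v = f0 v) \<and>
      (\<forall>a b t'. (a, b, t') \<in> set (sweep (Suc T)) \<longrightarrow> f0 a = 1 \<longrightarrow> f1 b \<noteq> 0) \<and> y \<le> max y0 (Suc T)"
    by (rule contacts_effect[OF 1]) (auto simp: sweep_iff dest: activeD)
  have "counted (f, x, y)"
    by (rule counted_outcomes[OF counted_start _ Suc.prems]) (use schedule_less in blast)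
  moreover have "y0 \<le> T" using IH(1,3,4,5) distinct_card[of vs] by (simp add: counted.simps)
  ultimately have card: "card {v. f v = 3} \<le> Suc T" using eff by (auto simp: counted.simps)
  have fin: "finite {v. f v = 3}"
    by (rule counted_finite[OF \<open>counted (f, x, y)\<close>]) simp
  \<comment> \<open>The vertices first defended in timestep \<open>Suc T\<close> are appended in an
    arbitrary order; what counts is that the whole list still fits into \<open>Suc T\<close>
    timesteps.\<close>
  then obtain us where us: "set us = {v. f v = 3} - set vs" "distinct us"
    using finite_distinct_list by blast
  have sub: "set vs \<subseteq> {v. f v = 3}" using IH(4) eff f by auto
  have vs: "distinct (vs @ us)" "set (vs @ us) = {v. f v = 3}" using us IH(3) sub by auto
  then have len: "length (vs @ us) \<le> Suc T" using card distinct_card by metis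
  have "burning G r (enact ((vs @ us) @ ws)) (Suc T) \<subseteq> {v. f v = 1}" for ws
  proof
    fix v assume v: "v \<in> burning G r (enact ((vs @ us) @ ws)) (Suc T)"
    have IH': "burning G r (enact ((vs @ us) @ ws)) T \<subseteq> {v. f0 v = 1}" using IH(6)[of "us @ ws"] by simp
    show "v \<in> {v. f v = 1}"
    proof (cases "v \<in> burning G r (enact ((vs @ us) @ ws)) T")
      case True
      then show ?thesis using IH' eff f by fastforce
    next
      case False
      then obtain u where u: "f0 u = 1" "active u v (Suc T)" "v \<notin> set (take (Suc T) ((vs @ us) @ ws))"
        using v IH' unfolding burning_Suc defended_enact by auto
      \<comment> \<open>All of \<open>vs @ us\<close> lies within the first \<open>Suc T\<close>
        defences, so a vertex missing from these is missing from \<open>vs @ us\<close>.\<close>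
      have "v \<notin> set (vs @ us)" using u(3) len by auto
      then have "f v \<noteq> 3" using vs by auto
      \<comment> \<open>A burning neighbour threatened \<open>v\<close>, so the branch touched it.
        It is not defended, and status 2 does not survive the marker, which leaves status 1.\<close>
      moreover have "f1 v \<noteq> 0" using eff u by (auto simp: sweep_iff)
      moreover have "f v < 4" using \<open>counted (f, x, y)\<close> by (simp add: counted.simps)
      ultimately show ?thesis using f by (auto split: if_splits)
    qed
  qed
  then show ?case using vs len \<open>counted (f, x, y)\<close> f
    by (intro conjI exI[of _ "vs @ us"]) auto
qed

text \<open>Following a strategy lazily burns no more vertices than the strategy does, and enacting
  a branch burns no more than the branch does. Inequalities suffice, as the question is only whether
  at least \<open>h\<close> vertices can be saved.\<close>

lemma firefighter_iff_branch:
  "temporal_firefighter G r h \<longleftrightarrow>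
    (\<exists>f x y. (f, x, y) \<in> outcomes remember_all (schedule (lifetime G)) start \<and> h \<le> int n - int x)"
proof
  assume "temporal_firefighter G r h"
  then obtain \<sigma> where h: "h \<le> int (card (saved G r \<sigma>))" unfolding temporal_firefighter_def by blast
  obtain z where "z \<in> outcomes remember_all (schedule (lifetime G)) start" "tracks \<sigma> (lifetime G) z"
    using tracks_schedule by blast
  then obtain f x y where f: "(f, x, y) \<in> outcomes remember_all (schedule (lifetime G)) start"
    "tracks \<sigma> (lifetime G) (f, x, y)" by (cases z) auto
  let ?B = "burning G r \<sigma> (lifetime G)"
  have fin: "finite ?B" using burning_less finite_subset by blast
  \<comment> \<open>\<open>enact_branch\<close> supplies the absence of status 2, which
    \<open>tracks\<close> would only place among the vertices burning one timestep after the
    lifetime.\<close>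
  have "{v. f v = 1 \<or> f v = 2} \<subseteq> ?B" using enact_branch[OF f(1)] f(2) by auto
  then have "x \<le> card ?B" using card_mono[OF fin] f(2) by (auto simp: counted.simps)
  moreover have "card (saved G r \<sigma>) = n - card ?B"
    unfolding saved_def verts using burning_less fin by (simp add: card_Diff_subset)
  moreover have "card ?B \<le> n" using card_mono[OF _ burning_less] by fastforce
  ultimately show "\<exists>f x y. (f, x, y) \<in> outcomes remember_all (schedule (lifetime G)) start \<and> h \<le> int n - int x"
    using f(1) h by (intro exI[of _ f] exI[of _ x] exI[of _ y]) auto
next
  assume "\<exists>f x y. (f, x, y) \<in> outcomes remember_all (schedule (lifetime G)) start \<and> h \<le> int n - int x"
  then obtain f x y where f: "(f, x, y) \<in> outcomes remember_all (schedule (lifetime G)) start"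
    and h: "h \<le> int n - int x" by blast
  obtain vs where vs: "counted (f, x, y)" "\<And>v. f v \<noteq> 2" "distinct vs" "set vs = {v. f v = 3}"
    "length vs \<le> lifetime G" "\<And>ws. burning G r (enact (vs @ ws)) (lifetime G) \<subseteq> {v. f v = 1}"
    using enact_branch[OF f] by blast
  let ?B = "burning G r (enact vs) (lifetime G)"
  have B: "?B \<subseteq> {v. f v = 1}" using vs(6)[of "[]"] by simp
  have "strategy G r (enact vs)"
    unfolding strategy_def
  proof (intro ballI allI impI)
    fix t v assume t: "t \<in> {1..lifetime G}" "enact vs t = Some v"
    then have i: "t - 1 < length vs" "v = vs ! (t - 1)" by (auto simp: enact_def split: if_splits)
    \<comment> \<open>Legality of the move: status 3 excludes \<open>v\<close> from the final
      burning set and thus from all earlier ones, and distinctness of \<open>vs\<close> excludes a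
      second defence.\<close>
    then have "f v = 3" using vs(4) nth_mem by blast
    moreover have "burning G r (enact vs) (t - 1) \<subseteq> ?B" by (rule burning_mono) (use t in auto)
    moreover have "v \<notin> set (take (t - 1) vs)"
      using i vs(3) by (auto simp: in_set_conv_nth nth_eq_iff_index_eq)
    ultimately show "v \<in> verts G \<and> v \<notin> burning G r (enact vs) (t - 1) \<and> v \<notin> defended G r (enact vs) (t - 1)"
      using B vs(1) verts by (auto simp: defended_enact counted.simps)
  qed
  moreover have "card (saved G r (enact vs)) = n - card ?B"
    unfolding saved_def verts using burning_less finite_subset[OF burning_less]
    by (simp add: card_Diff_subset)
  moreover have "card ?B \<le> x"
  proof -
    have "{v. f v = 1 \<or> f v = 2} = {v. f v = 1}" using vs(2) by auto
    moreover have "finite {v. f v = 1}" by (rule counted_finite[OF vs(1)]) simp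
    ultimately show ?thesis using vs(1) B card_mono[of "{v. f v = 1}" ?B] by (simp add: counted.simps)
  qed
  ultimately show "temporal_firefighter G r h" unfolding temporal_firefighter_def using h
    by (intro exI[of _ "enact vs"]) auto
qed

text \<open>Agreement preserves the counter \<open>x\<close>, and acceptance of a final state
  depends on nothing else.\<close>

lemma firefighter_iff_reached:
  "temporal_firefighter G r h \<longleftrightarrow>
    (\<exists>f x y. (f, x, y) \<in> reached (length (schedule (lifetime G))) \<and> h \<le> int n - int x)"
proof -
  have "rel_set (agree (lifetime G)) (reached (length (schedule (lifetime G))))
      (outcomes remember_all (schedule (lifetime G)) start)"
    using agree_schedule unfolding reached_def by simp
  then show ?thesis unfolding firefighter_iff_branch rel_set_def by fastforce
qed

end

section \<open>The program\<close>

abbreviation scalar :: "string \<Rightarrow> aexp" where "scalar x \<equiv> Get x (Num 0)"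

abbreviation assign :: "string \<Rightarrow> aexp \<Rightarrow> com" (infix ":=:" 62) where
  "x :=: a \<equiv> Put x (Num 0) a"

abbreviation seq (infixr ";;" 60) where "c ;; d \<equiv> Seq c d"

abbreviation increment :: "string \<Rightarrow> com" where
  "increment x \<equiv> x :=: Add (scalar x) (Num 1)"

text \<open>Four equal summands replace a multiplication by 4. The exponents go up to
  \<open>3 * n\<close> because a key has three blocks of \<open>n\<close> base-4 digits below the
  position.\<close>

definition weights_prog :: com where
  "weights_prog = (''i'' :=: Num 0 ;; Put ''w'' (Num 0) (Num 1)) ;;
     While (Less (scalar ''i'') (Add (scalar ''n'') (Add (scalar ''n'') (scalar ''n''))))
       (Put ''w'' (Add (scalar ''i'') (Num 1))
          (Add (Add (Get ''w'' (scalar ''i'')) (Get ''w'' (scalar ''i'')))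
            (Add (Get ''w'' (scalar ''i'')) (Get ''w'' (scalar ''i'')))) ;;
        increment ''i'')"

text \<open>\<open>owner[p]\<close> is the edge to which the label \<open>lab[p]\<close> belongs.\<close>

definition owners_prog :: com where
  "owners_prog = (''e'' :=: Num 0 ;; ''p'' :=: Num 0) ;;
     While (Less (scalar ''e'') (scalar ''m''))
       (''j'' :=: Num 0 ;;
        While (Less (scalar ''j'') (Get ''len'' (scalar ''e'')))
          (Put ''owner'' (scalar ''p'') (scalar ''e'') ;; increment ''p'' ;; increment ''j'') ;;
        increment ''e'')"

definition lifetime_prog :: com where
  "lifetime_prog = (''life'' :=: Num 0 ;; ''i'' :=: Num 0) ;;
     While (Less (scalar ''i'') (scalar ''p''))
       (Cond (Less (scalar ''life'') (Get ''lab'' (scalar ''i'')))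
          (''life'' :=: Get ''lab'' (scalar ''i'')) Skip ;;
        increment ''i'')"

text \<open>\<open>row[e]\<close> is the start of row \<open>e\<close> in \<open>act\<close>, the
  flattened table of edges against labels. The width \<open>life + 1\<close> leaves room for all
  labels from 0 up to the lifetime.\<close>

definition rows_prog :: com where
  "rows_prog = (''e'' :=: Num 0 ;; Put ''row'' (Num 0) (Num 0)) ;;
     While (Less (scalar ''e'') (scalar ''m''))
       (Put ''row'' (Add (scalar ''e'') (Num 1))
          (Add (Get ''row'' (scalar ''e'')) (Add (scalar ''life'') (Num 1))) ;;
        increment ''e'')"

text \<open>Once all labels have been seen, \<open>last[v]\<close> is the greatest label at
  \<open>v\<close>, so \<open>later t v\<close> is decided by the single comparison
  \<open>t < last[v]\<close>. A vertex without labels keeps the value 0, which makes the comparison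
  fail for every \<open>t\<close>.\<close>

definition raise_last :: "aexp \<Rightarrow> com" where
  "raise_last v = Cond (Less (Get ''last'' v) (scalar ''t'')) (Put ''last'' v (scalar ''t'')) Skip"

definition active_prog :: com where
  "active_prog = ''i'' :=: Num 0 ;;
     While (Less (scalar ''i'') (scalar ''p''))
       (''e'' :=: Get ''owner'' (scalar ''i'') ;; ''t'' :=: Get ''lab'' (scalar ''i'') ;;
        Put ''act'' (Add (Get ''row'' (scalar ''e'')) (scalar ''t'')) (Num 1) ;;
        raise_last (Get ''src'' (scalar ''e'')) ;; raise_last (Get ''dst'' (scalar ''e'')) ;;
        increment ''i'')"

definition emit :: "aexp \<Rightarrow> aexp \<Rightarrow> com" where
  "emit a b = Put ''opA'' (scalar ''ops'') a ;; Put ''opB'' (scalar ''ops'') b ;;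
     Put ''opT'' (scalar ''ops'') (scalar ''t'') ;; increment ''ops''"

definition schedule_prog :: com where
  "schedule_prog = (''ops'' :=: Num 0 ;; ''t'' :=: Num 1) ;;
     While (Less (scalar ''t'') (Add (scalar ''life'') (Num 1)))
       ((''e'' :=: Num 0 ;;
        While (Less (scalar ''e'') (scalar ''m''))
          (Cond (Equal (Get ''act'' (Add (Get ''row'' (scalar ''e'')) (scalar ''t''))) (Num 1))
             (emit (Get ''src'' (scalar ''e'')) (Get ''dst'' (scalar ''e'')) ;;
              emit (Get ''dst'' (scalar ''e'')) (Get ''src'' (scalar ''e''))) Skip ;;
           increment ''e'')) ;;
        (emit (Num 0) (Num 0) ;; increment ''t''))"

lemma modified_progs [simp]:
  "modified weights_prog = {''i'', ''w''}"
  "modified owners_prog = {''e'', ''p'', ''j'', ''owner''}"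
  "modified lifetime_prog = {''life'', ''i''}"
  "modified rows_prog = {''e'', ''row''}"
  "modified active_prog = {''i'', ''e'', ''t'', ''act'', ''last''}"
  "modified schedule_prog = {''opA'', ''opB'', ''opT'', ''ops'', ''t'', ''e''}"
  by (auto simp: weights_prog_def owners_prog_def lifetime_prog_def rows_prog_def active_prog_def
    raise_last_def schedule_prog_def emit_def)

context firefighter_input
begin

subsection \<open>Preprocessing\<close>

fun input_ok :: "store \<Rightarrow> bool" where
  "input_ok s \<longleftrightarrow> s ''n'' 0 = int n \<and> s ''root'' 0 = int r \<and> s ''m'' 0 = int (length es) \<and>
     (\<forall>e<length es. s ''src'' (int e) = int (src e) \<and> s ''dst'' (int e) = int (dst e) \<and>
        s ''len'' (int e) = int (length (labs e)))"

text \<open>The order is that of the input array \<open>lab\<close>, whose cells are the second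
  components; \<open>owner\<close> will hold the first ones.\<close>

definition occurrences_upto :: "nat \<Rightarrow> (nat \<times> nat) list" where
  "occurrences_upto e = concat (map (\<lambda>e. map (Pair e) (labs e)) [0..<e])"

abbreviation occurrences :: "(nat \<times> nat) list" where
  "occurrences \<equiv> occurrences_upto (length es)"

lemma occurrences_upto_Suc: "occurrences_upto (Suc e) = occurrences_upto e @ map (Pair e) (labs e)"
  by (simp add: occurrences_upto_def)

lemma occurrences_iff: "(e, t) \<in> set occurrences \<longleftrightarrow> e < length es \<and> t \<in> set (labs e)"
  by (auto simp: occurrences_upto_def)

lemma length_occurrences: "length occurrences \<le> length es * (lifetime G + 1)"
proof -
  have "e \<le> length es \<Longrightarrow> length (occurrences_upto e) \<le> e * (lifetime G + 1)" for e
  proof (induction e)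
    case (Suc e)
    then show ?case using length_labs[of e] by (simp add: occurrences_upto_Suc)
  qed (simp add: occurrences_upto_def)
  then show ?thesis by simp
qed

lemma occurrence_less: assumes "i < length occurrences"
  shows "fst (occurrences ! i) < length es" "snd (occurrences ! i) \<le> lifetime G"
proof -
  obtain e t where et: "occurrences ! i = (e, t)" by (cases "occurrences ! i")
  then have "(e, t) \<in> set occurrences" using assms nth_mem by metis
  then have "e < length es" "t \<in> set (labs e)" by (auto simp: occurrences_iff)
  moreover from this have "active (src e) (dst e) t" unfolding active_iff by blast
  ultimately show "fst (occurrences ! i) < length es" "snd (occurrences ! i) \<le> lifetime G"
    using et activeD(4) by auto
qed

lemma lifetime_occurrences: "lifetime G = Max (insert 0 (snd ` set occurrences))"
proof -
  have "(\<Union>E\<in>edges G. labels G E) = snd ` set occurrences"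
  proof (intro equalityI subsetI)
    fix t assume "t \<in> (\<Union>E\<in>edges G. labels G E)"
    then obtain E where E: "E \<in> edges G" "t \<in> labels G E" by blast
    then obtain e where "e < length es" "E = {src e, dst e}" using edge_index by blast
    then have "(e, t) \<in> set occurrences" using E labels_enum by (simp add: occurrences_iff)
    then show "t \<in> snd ` set occurrences" by force
  next
    fix t assume "t \<in> snd ` set occurrences"
    then obtain e where "(e, t) \<in> set occurrences" by force
    then have "e < length es" "t \<in> labels G {src e, dst e}" using labels_enum by (auto simp: occurrences_iff)
    then show "t \<in> (\<Union>E\<in>edges G. labels G E)" using labels_enum(3) by blast
  qed
  then show ?thesis by (simp add: lifetime_def)
qed

lemma runs_weights:
  assumes "input_ok s0"
  shows "runs weights_prog s0 (200 * (n + 1)) (\<lambda>s. \<forall>k\<le>3 * n. s ''w'' (int k) = 4 ^ k)"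
proof -
  let ?I = "\<lambda>k s. s ''i'' 0 = int k \<and> k \<le> 3 * n \<and> (\<forall>j\<le>k. s ''w'' (int j) = 4 ^ j)"
  show ?thesis unfolding weights_prog_def
    by (rule runs_init_While_loop_free[where I = ?I and N = "3 * n"])
      (use assms in \<open>auto simp: le_Suc_eq\<close>)
qed

text \<open>There are at most \<open>n ^ 2\<close> edges with at most \<open>lifetime G + 1\<close>
  labels each. The inner invariant describes what has been written as all earlier edges followed by
  a prefix of the current label list.\<close>

lemma runs_owners:
  assumes "input_ok s0"
  shows "runs owners_prog s0 (100 * ((n ^ 2) * (lifetime G + 3) + 1)) (\<lambda>s. s ''p'' 0 = int (length occurrences) \<and>
    (\<forall>i<length occurrences. s ''owner'' (int i) = int (fst (occurrences ! i))))"
proof -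
  let ?P = "\<lambda>xs s. s ''p'' 0 = int (length xs) \<and> (\<forall>i<length xs. s ''owner'' (int i) = int (fst (xs ! i)))"
  let ?I = "\<lambda>e s. s ''e'' 0 = int e \<and> e \<le> length es \<and> ?P (occurrences_upto e) s"
  let ?J = "\<lambda>e j s. s ''j'' 0 = int j \<and> j \<le> length (labs e) \<and>
    ?P (occurrences_upto e @ map (Pair e) (take j (labs e))) s"
  have inner: "runs (''j'' :=: Num 0 ;;
        While (Less (scalar ''j'') (Get ''len'' (scalar ''e'')))
          (Put ''owner'' (scalar ''p'') (scalar ''e'') ;; increment ''p'' ;; increment ''j'') ;;
        increment ''e'') s (40 * (lifetime G + 2)) (?I (Suc e))"
    if s: "s ''e'' 0 = int e" "e < length es" "?P (occurrences_upto e) s"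
      "\<And>x. x \<notin> {''j'', ''owner'', ''p'', ''e''} \<Longrightarrow> s x = s0 x" for e s
  proof (rule runs_Seq_loop_free[where l = "length (labs e) * 27 + 15",
        OF _ runs_Seq[where P = "?J e (length (labs e))" and k = "length (labs e) * 27 + 7" and l = 8]],
      goal_cases)
    case 2
    show ?case
    proof (rule runs_While[where I = "?J e" and N = "length (labs e)" and k = 20], goal_cases)
      case (2 j t)
      then have "t ''e'' 0 = int e" "t ''len'' (int e) = int (length (labs e))"
        using s assms by simp_all
      with 2 show ?case
        by (intro conjI runs_loop_free)
          (auto simp: take_Suc_conv_app_nth nth_append less_Suc_eq)
    next
      case (3 j t)
      then have "t ''e'' 0 = int e" "t ''len'' (int e) = int (length (labs e))"
        using s assms by simp_all
      with 3 show ?case by auto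
    qed (use s in auto)
  next
    case (3 t)
    then have "t ''e'' 0 = int e" using s by simp
    with 3 s show ?case by (intro runs_loop_free) (auto simp: occurrences_upto_Suc)
  qed (use length_labs[OF s(2)] in auto)
  show ?thesis unfolding owners_prog_def
  proof (rule runs_init_While[where I = ?I and N = "length es" and k = "40 * (lifetime G + 2)"], goal_cases)
    case (3 e s)
    then have "e < length es" using assms by simp
    with 3 show ?case by (intro conjI inner) auto
  next
    case 5
    show ?case using mult_right_mono[OF number_of_edges, of "40 * (lifetime G + 2) + 10"]
      by (simp add: algebra_simps)
  qed (use assms in \<open>auto simp: occurrences_upto_def\<close>)
qed

lemma runs_lifetime:
  assumes "s0 ''p'' 0 = int (length occurrences)"
    "\<forall>i<length occurrences. s0 ''lab'' (int i) = int (snd (occurrences ! i))"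
  shows "runs lifetime_prog s0 (40 * (length occurrences + 1)) (\<lambda>s. s ''life'' 0 = int (lifetime G))"
proof -
  let ?I = "\<lambda>i s. s ''i'' 0 = int i \<and> i \<le> length occurrences \<and>
    s ''life'' 0 = int (Max (insert 0 (snd ` set (take i occurrences))))"
  show ?thesis unfolding lifetime_prog_def
  proof (rule runs_init_While_loop_free[where I = ?I and N = "length occurrences"], goal_cases)
    case (4 i s)
    then have i: "i < length occurrences" using assms by simp
    let ?A = "snd ` set (take i occurrences)"
    have "insert 0 (snd ` set (take (Suc i) occurrences)) =
        insert (snd (occurrences ! i)) (insert 0 ?A)"
      using i by (simp add: take_Suc_conv_app_nth insert_commute)
    moreover have "Max (insert x (insert 0 ?A)) = max x (Max (insert 0 ?A))" for x
      by (rule Max_insert) simp_all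
    ultimately have "Max (insert 0 (snd ` set (take (Suc i) occurrences))) =
      max (snd (occurrences ! i)) (Max (insert 0 ?A))" by (simp only:)
    moreover define M where "M = Max (insert 0 ?A)"
    ultimately have M: "Max (insert 0 (snd ` set (take (Suc i) occurrences))) =
      max (snd (occurrences ! i)) M" by simp
    have "s ''life'' 0 = int M" "s ''i'' 0 = int i" "s ''lab'' (int i) = int (snd (occurrences ! i))"
      using 4 i assms unfolding M_def by simp_all
    then show ?case unfolding M using i by simp
  qed (use assms in \<open>auto simp: lifetime_occurrences\<close>)
qed

lemma runs_rows:
  assumes "input_ok s0" "s0 ''life'' 0 = int (lifetime G)"
  shows "runs rows_prog s0 (40 * (length es + 1))
    (\<lambda>s. \<forall>e\<le>length es. s ''row'' (int e) = int (e * (lifetime G + 1)))"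
proof -
  let ?I = "\<lambda>e s. s ''e'' 0 = int e \<and> e \<le> length es \<and>
    (\<forall>k\<le>e. s ''row'' (int k) = int (k * (lifetime G + 1)))"
  show ?thesis unfolding rows_prog_def
    by (rule runs_init_While_loop_free[where I = ?I and N = "length es"])
      (use assms in \<open>auto simp: le_Suc_eq algebra_simps\<close>)
qed

end

lemma effect_raise_last: "effect (raise_last v) s =
  s(''last'' := (s ''last'')(aval v s := max (s ''last'' (aval v s)) (s ''t'' 0)))"
  by (auto simp: raise_last_def max_def)

lemma raise_last_simps [simp]: "loop_free (raise_last v)" "modified (raise_last v) = {''last''}"
  "cost_bound (raise_last v) = 2 * acost v + 9"
  by (auto simp: raise_last_def)

lemma emit_simps [simp]: "loop_free (emit a b)" "modified (emit a b) = {''opA'', ''opB'', ''opT'', ''ops''}"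
  "cost_bound (emit a b) = acost a + acost b + 17"
  by (auto simp: emit_def)

definition represents_ops :: "(nat \<times> nat \<times> nat) list \<Rightarrow> store \<Rightarrow> bool" where
  "represents_ops l s \<longleftrightarrow> s ''ops'' 0 = int (length l) \<and>
     (\<forall>i<length l. s ''opA'' (int i) = int (fst (l ! i)) \<and> s ''opB'' (int i) = int (fst (snd (l ! i))) \<and>
        s ''opT'' (int i) = int (snd (snd (l ! i))))"

lemma represents_ops_cong:
  assumes "\<And>x. x \<in> {''opA'', ''opB'', ''opT'', ''ops''} \<Longrightarrow> s' x = s x"
  shows "represents_ops l s' \<longleftrightarrow> represents_ops l s"
  using assms by (simp add: represents_ops_def)

text \<open>The value of \<open>b\<close> is required for all contents of \<open>opA\<close>,
  because that array is written before \<open>b\<close> is evaluated.\<close>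

lemma represents_ops_emit:
  assumes "represents_ops l s" "s ''t'' 0 = int t"
    "\<And>k. aval a (s(''opA'' := k)) = int x" "aval a s = int x" "\<And>k. aval b (s(''opA'' := k)) = int y"
  shows "represents_ops (l @ [(x, y, t)]) (effect (emit a b) s)"
  using assms by (auto simp: represents_ops_def emit_def nth_append less_Suc_eq)

context firefighter_input
begin

text \<open>Uniqueness of division with remainder, as \<open>t\<close> and \<open>t'\<close> are
  below the row width.\<close>

lemma row_address:
  assumes "t \<le> lifetime G" "t' \<le> lifetime G"
  shows "e * (lifetime G + 1) + t = e' * (lifetime G + 1) + t' \<longleftrightarrow> e = e' \<and> t = t'"
proof
  assume *: "e * (lifetime G + 1) + t = e' * (lifetime G + 1) + t'"
  have div: "k < N \<Longrightarrow> (m * N + k) div N = m" for k m N :: nat by simp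
  have "(e * (lifetime G + 1) + t) div (lifetime G + 1) = e"
    "(e' * (lifetime G + 1) + t') div (lifetime G + 1) = e'"
    by (rule div; use assms in simp)+
  then show "e = e' \<and> t = t'" using * by auto
qed auto

lemma later_occurrences:
  "later t v \<longleftrightarrow> (\<exists>(e, t')\<in>set occurrences. (v = src e \<or> v = dst e) \<and> t < t')"
proof
  assume "later t v"
  then obtain u t' where "active v u t'" "t < t'" unfolding later_def by blast
  then obtain e where "e < length es" "{v, u} = {src e, dst e}" "t' \<in> set (labs e)"
    unfolding active_iff by blast
  then have "(e, t') \<in> set occurrences" "v = src e \<or> v = dst e"
    by (auto simp: occurrences_iff doubleton_eq_iff)
  then show "\<exists>(e, t')\<in>set occurrences. (v = src e \<or> v = dst e) \<and> t < t'" using \<open>t < t'\<close> by blast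
next
  assume "\<exists>(e, t')\<in>set occurrences. (v = src e \<or> v = dst e) \<and> t < t'"
  then obtain e t' where e: "(e, t') \<in> set occurrences" "v = src e \<or> v = dst e" "t < t'" by blast
  then have "active (src e) (dst e) t'" unfolding active_iff occurrences_iff by blast
  then show "later t v" unfolding later_def using e(2,3) active_sym by blast
qed

text \<open>\<open>last\<close> is described through its thresholds instead of a maximum, so that
  the empty set needs no special treatment and the clause becomes \<open>later\<close> once
  \<open>A\<close> holds all occurrences.\<close>

fun activity :: "store \<Rightarrow> (nat \<times> nat) set \<Rightarrow> bool" where
  "activity s A \<longleftrightarrow>
     (\<forall>e<length es. \<forall>t\<le>lifetime G.
        s ''act'' (int (e * (lifetime G + 1) + t)) = (if (e, t) \<in> A then 1 else 0)) \<and>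
     (\<forall>v t. int t < s ''last'' (int v) \<longleftrightarrow> (\<exists>(e, t')\<in>A. (v = src e \<or> v = dst e) \<and> t < t'))"

lemma runs_active:
  assumes "input_ok s0" "s0 ''p'' 0 = int (length occurrences)"
    "\<forall>i<length occurrences. s0 ''lab'' (int i) = int (snd (occurrences ! i))"
    "\<forall>i<length occurrences. s0 ''owner'' (int i) = int (fst (occurrences ! i))"
    "\<forall>e\<le>length es. s0 ''row'' (int e) = int (e * (lifetime G + 1))"
    "s0 ''act'' = (\<lambda>_. 0)" "s0 ''last'' = (\<lambda>_. 0)"
  shows "runs active_prog s0 (100 * (length occurrences + 1)) (\<lambda>s. activity s (set occurrences))"
proof -
  let ?I = "\<lambda>i s. s ''i'' 0 = int i \<and> i \<le> length occurrences \<and> activity s (set (take i occurrences))"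
  show ?thesis unfolding active_prog_def
  proof (rule runs_init_While_loop_free[where I = ?I and N = "length occurrences"], goal_cases)
    case (4 i s)
    then have i: "i < length occurrences" using assms by simp
    obtain e t where et: "occurrences ! i = (e, t)" by (cases "occurrences ! i")
    then have le: "e < length es" "t \<le> lifetime G" using occurrence_less[OF i] by auto
    let ?c = "''e'' :=: Get ''owner'' (scalar ''i'') ;; ''t'' :=: Get ''lab'' (scalar ''i'') ;;
        Put ''act'' (Add (Get ''row'' (scalar ''e'')) (scalar ''t'')) (Num 1) ;;
        raise_last (Get ''src'' (scalar ''e'')) ;; raise_last (Get ''dst'' (scalar ''e'')) ;;
        increment ''i''"
    have s: "s ''i'' 0 = int i" "s ''owner'' (int i) = int e" "s ''lab'' (int i) = int t"
      "s ''row'' (int e) = int (e * (lifetime G + 1))" "s ''src'' (int e) = int (src e)"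
      "s ''dst'' (int e) = int (dst e)"
      using 4 assms i et le by auto
    \<comment> \<open>The endpoints of an edge differ, so the second \<open>raise_last\<close> reads
      an entry that the first has left alone.\<close>
    have act: "effect ?c s ''act'' = (s ''act'')(int (e * (lifetime G + 1) + t) := 1)"
      and last: "effect ?c s ''last'' = (s ''last'')(int (src e) := max (s ''last'' (int (src e))) (int t),
        int (dst e) := max (s ''last'' (int (dst e))) (int t))"
      and idx: "effect ?c s ''i'' 0 = int (Suc i)"
      using s src_dst_less(3)[OF le(1)] by (simp_all add: effect_raise_last)
    have set: "set (take (Suc i) occurrences) = insert (e, t) (set (take i occurrences))"
      using i et by (simp add: take_Suc_conv_app_nth)
    have "activity (effect ?c s) (insert (e, t) (set (take i occurrences)))"
    proof (unfold activity.simps act last, intro conjI allI impI, goal_cases)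
      case (1 e' t')
      have "int (e' * (lifetime G + 1) + t') = int (e * (lifetime G + 1) + t) \<longleftrightarrow> e' = e \<and> t' = t"
        unfolding of_nat_eq_iff using row_address[OF 1(2) le(2)] .
      then show ?case using 4(1) 1 unfolding activity.simps fun_upd_apply by simp
    next
      case (2 v t')
      have "int t' < s ''last'' (int v) \<longleftrightarrow>
        (\<exists>(e, t'')\<in>set (take i occurrences). (v = src e \<or> v = dst e) \<and> t' < t'')"
        using 4(1) unfolding activity.simps by blast
      moreover have "int t' < ((s ''last'')(int (src e) := max (s ''last'' (int (src e))) (int t),
          int (dst e) := max (s ''last'' (int (dst e))) (int t))) (int v) \<longleftrightarrow>
        (v = src e \<or> v = dst e) \<and> t' < t \<or> int t' < s ''last'' (int v)"
        using src_dst_less(3)[OF le(1)] by (auto simp: less_max_iff_disj)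
      ultimately show ?case unfolding bex_simps by simp
    qed
    then show ?case using idx i unfolding set by simp
  qed (use assms in auto)
qed

lemma runs_schedule:
  assumes "input_ok s0" "s0 ''life'' 0 = int (lifetime G)"
    "\<forall>e\<le>length es. s0 ''row'' (int e) = int (e * (lifetime G + 1))" "activity s0 (set occurrences)"
  shows "runs schedule_prog s0 (300 * (lifetime G * (length es + 1) + 1))
    (represents_ops (schedule (lifetime G)))"
proof -
  let ?I = "\<lambda>T s. s ''t'' 0 = int (Suc T) \<and> T \<le> lifetime G \<and> represents_ops (schedule T) s"
  let ?J = "\<lambda>T e s. s ''e'' 0 = int e \<and> e \<le> length es \<and> s ''t'' 0 = int (Suc T) \<and>
    represents_ops (schedule T @ concat (map (contacts (Suc T)) [0..<e])) s"
  let ?c = "Cond (Equal (Get ''act'' (Add (Get ''row'' (scalar ''e'')) (scalar ''t''))) (Num 1))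
             (emit (Get ''src'' (scalar ''e'')) (Get ''dst'' (scalar ''e'')) ;;
              emit (Get ''dst'' (scalar ''e'')) (Get ''src'' (scalar ''e''))) Skip ;;
           increment ''e''"
  have inner: "runs ((''e'' :=: Num 0 ;; While (Less (scalar ''e'') (scalar ''m'')) ?c) ;;
        (emit (Num 0) (Num 0) ;; increment ''t''))
      s (200 * (length es + 1)) (?I (Suc T))"
    if s: "s ''t'' 0 = int (Suc T)" "T < lifetime G" "represents_ops (schedule T) s"
      "\<And>x. x \<notin> {''opA'', ''opB'', ''opT'', ''ops'', ''t'', ''e''} \<Longrightarrow> s x = s0 x" for T s
  proof (rule runs_Seq[where P = "?J T (length es)" and k = "130 * (length es + 1)" and l = 40], goal_cases)
    case 1
    show ?case
    proof (rule runs_init_While_loop_free[where I = "?J T" and N = "length es"], goal_cases)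
      case 3
      show ?case using s by (simp add: represents_ops_def)
    next
      case (4 e u)
      have "u ''m'' 0 = int (length es)" using 4(2) s(4) assms(1) by simp
      then have e: "e < length es" using 4 by simp
      have u: "u ''e'' 0 = int e" "u ''t'' 0 = int (Suc T)" "u ''row'' (int e) = int (e * (lifetime G + 1))"
        "u ''src'' (int e) = int (src e)" "u ''dst'' (int e) = int (dst e)"
        using 4 s(2,4) assms e by simp_all
      have "s0 ''act'' (int (e * (lifetime G + 1) + Suc T)) = (if (e, Suc T) \<in> set occurrences then 1 else 0)"
        using assms(4) e s(2) Suc_leI unfolding activity.simps by blast
      moreover have "u ''act'' = s0 ''act''" using 4(2) s(4) by simp
      ultimately have act: "u ''act'' (int (e * (lifetime G + 1) + Suc T)) = (if Suc T \<in> set (labs e) then 1 else 0)"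
        using e by (simp only: occurrences_iff simp_thms)
      have b: "bval (Equal (Get ''act'' (Add (Get ''row'' (scalar ''e'')) (scalar ''t''))) (Num 1)) u \<longleftrightarrow>
        Suc T \<in> set (labs e)"
      proof -
        have "aval (Add (Get ''row'' (scalar ''e'')) (scalar ''t'')) u = int (e * (lifetime G + 1) + Suc T)"
          using u by simp
        then show ?thesis using act unfolding bval.simps aval.simps(2) by (simp only: aval.simps) simp
      qed
      let ?l = "schedule T @ concat (map (contacts (Suc T)) [0..<e])"
      let ?u = "effect (emit (Get ''src'' (scalar ''e'')) (Get ''dst'' (scalar ''e''))) u"
      have *: "represents_ops (?l @ [(src e, dst e, Suc T)]) ?u"
        by (rule represents_ops_emit) (use 4(1) u in auto)
      have u': "?u ''e'' 0 = int e" "?u ''t'' 0 = int (Suc T)" "?u ''src'' (int e) = int (src e)"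
        "?u ''dst'' (int e) = int (dst e)" using u by (auto simp: effect_frame)
      have "represents_ops ((?l @ [(src e, dst e, Suc T)]) @ [(dst e, src e, Suc T)])
        (effect (emit (Get ''dst'' (scalar ''e'')) (Get ''src'' (scalar ''e''))) ?u)"
        by (rule represents_ops_emit[OF *]) (use u' in auto)
      then have "represents_ops (schedule T @ concat (map (contacts (Suc T)) [0..<Suc e])) (effect ?c u)"
        using b 4(1) by (auto simp: contacts_def represents_ops_def)
      moreover have "effect ?c u ''t'' = u ''t''" by (rule effect_frame) simp
      moreover have "effect ?c u ''e'' 0 = int (Suc e)"
      proof -
        have "effect ?c u = effect (increment ''e'') (effect (Cond (Equal (Get ''act'' (Add (Get ''row'' (scalar ''e'')) (scalar ''t''))) (Num 1))
             (emit (Get ''src'' (scalar ''e'')) (Get ''dst'' (scalar ''e'')) ;;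
              emit (Get ''dst'' (scalar ''e'')) (Get ''src'' (scalar ''e''))) Skip) u)" (is "_ = effect _ ?v")
          by simp
        moreover have "?v ''e'' = u ''e''" by (rule effect_frame) simp
        ultimately show ?thesis using u by simp
      qed
      ultimately show ?case using e u(2) by simp
    next
      case (5 e u)
      have "u ''m'' 0 = int (length es)" using 5(2) s(4) assms(1) by simp
      then have "e = length es" using 5(1,3) by simp
      then show ?case using 5(1) by (simp only:)
    qed simp_all
  next
    case (2 u)
    have "represents_ops ((schedule T @ sweep (Suc T)) @ [(0, 0, Suc T)]) (effect (emit (Num 0) (Num 0)) u)"
      by (rule represents_ops_emit) (use 2(1) in \<open>auto simp: sweep_def\<close>)
    moreover have "effect (emit (Num 0) (Num 0)) u ''t'' = u ''t''" by (rule effect_frame) simp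
    ultimately show ?case using 2(1) s(2)
      by (intro runs_loop_free) (auto simp: schedule_Suc represents_ops_def)
  qed simp
  show ?thesis unfolding schedule_prog_def
  proof (rule runs_init_While[where I = ?I and N = "lifetime G" and k = "200 * (length es + 1)"], goal_cases)
    case (3 T s)
    have "T < lifetime G" using 3 assms(2) by simp
    then show ?case using 3 by (intro conjI inner) auto
  qed (use assms in \<open>auto simp: schedule_0 represents_ops_def algebra_simps\<close>)
qed

end

subsection \<open>Keys of search nodes\<close>

definition code :: "(nat \<Rightarrow> nat) \<Rightarrow> nat \<Rightarrow> int" where
  "code f u = (\<Sum>v<u. int (f v) * 4 ^ v)"

lemma code_0 [simp]: "code f 0 = 0" and
  code_Suc: "code f (Suc u) = code f u + int (f u) * 4 ^ u"
  by (simp_all add: code_def)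

lemma code_bounds:
  assumes "\<And>v. f v < 4" shows "0 \<le> code f u" "code f u < 4 ^ u"
proof -
  have "0 \<le> code f u \<and> code f u < 4 ^ u"
  proof (induction u)
    case (Suc u)
    have "int (f u) \<le> 3" using assms[of u] by simp
    then have "int (f u) * 4 ^ u \<le> 3 * 4 ^ u" by (rule mult_right_mono) simp
    moreover have "0 \<le> int (f u) * 4 ^ u" by simp
    ultimately show ?case using Suc unfolding code_Suc power_Suc by linarith
  qed simp
  then show "0 \<le> code f u" "code f u < 4 ^ u" by auto
qed

lemma digit_unique:
  fixes a b M x y :: int
  assumes "0 \<le> a" "a < M" "0 \<le> b" "b < M" "a + M * x = b + M * y"
  shows "a = b" "x = y"
proof -
  have "(a + M * x) div M = x" "(b + M * y) div M = y" using assms(1-4) by auto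
  then show "x = y" using assms(5) by simp
  then show "a = b" using assms(5) by simp
qed

lemma code_inj:
  assumes "\<And>v. f v < 4" "\<And>v. g v < 4" "code f u = code g u" "v < u"
  shows "f v = g v"
  using assms(3,4)
proof (induction u)
  case (Suc u)
  have "code f u = code g u" "int (f u) = int (g u)"
    using digit_unique[of "code f u" "4 ^ u" "code g u" "int (f u)" "int (g u)"]
      code_bounds[OF assms(1)] code_bounds[OF assms(2)] Suc.prems(1) by (simp_all add: code_Suc mult.commute)
  then show ?case using Suc by (cases "v = u") auto
qed simp

text \<open>This is why the machine can change a status by adding a weight two or three times to the
  code.\<close>

lemma code_upd: "v < u \<Longrightarrow> code (f(v := c)) u = code f u + (int c - int (f v)) * 4 ^ v"
proof (induction u)
  case (Suc u)
  have "v = u \<Longrightarrow> code (f(v := c)) u = code f u" by (simp add: code_def)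
  then show ?case using Suc by (cases "v = u") (auto simp: code_Suc algebra_simps fun_upd_same fun_upd_other simp del: fun_upd_apply)
qed simp

text \<open>Base \<open>4\<close> for the statuses and base \<open>4 ^ n > n\<close> for the two counters: all weights are powers
  of \<open>4\<close>, which the machine obtains by additions. Unbounded cells make these sparse keys usable
  as addresses.\<close>

type_synonym node = "nat \<times> state"

fun key :: "nat \<Rightarrow> node \<Rightarrow> int" where
  "key n (k, f, x, y) = code f n + 4 ^ n * int x + 4 ^ (n + n) * int y + 4 ^ (n + n + n) * int k"

fun legal :: "nat \<Rightarrow> node \<Rightarrow> bool" where
  "legal n (k, f, x, y) \<longleftrightarrow> (\<forall>v. f v < 4) \<and> (\<forall>v. f v \<noteq> 0 \<longrightarrow> v < n) \<and> x \<le> n \<and> y \<le> n"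

text \<open>In Horner form with base \<open>4 ^ n\<close>, the code and the two counters are digits
  below the base, and the position is the unbounded leading part. Division with remainder peels them
  off one by one.\<close>

lemma key_inj:
  assumes "legal n a" "legal n b" "key n a = key n b" shows "a = b"
proof -
  obtain k f x y where a: "a = (k, f, x, y)" by (cases a) auto
  obtain l g u w where b: "b = (l, g, u, w)" by (cases b) auto
  let ?M = "4 ^ n :: int"
  have small: "int m < ?M" if "m \<le> n" for m
  proof -
    have "n < 4 ^ n" by (induction n) auto
    then have "m < 4 ^ n" using that by (rule le_less_trans[rotated])
    then have "int m < int (4 ^ n)" by (simp only: of_nat_less_iff)
    then show ?thesis by simp
  qed
  have f: "0 \<le> code f n" "code f n < ?M" "0 \<le> code g n" "code g n < ?M"
    using assms(1,2) a b code_bounds by auto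
  have eq: "code f n + ?M * (int x + ?M * (int y + ?M * int k)) =
    code g n + ?M * (int u + ?M * (int w + ?M * int l))"
    using assms(3) a b by (simp add: algebra_simps power_add)
  have 1: "code f n = code g n" "int x + ?M * (int y + ?M * int k) = int u + ?M * (int w + ?M * int l)"
    using digit_unique[OF f eq] by auto
  have 2: "int x = int u" "int y + ?M * int k = int w + ?M * int l"
    using digit_unique[OF _ _ _ _ 1(2)] small assms(1,2) a b by auto
  have 3: "int y = int w" "int k = int l"
    using digit_unique[OF _ _ _ _ 2(2)] small assms(1,2) a b by auto
  have "f v = g v" for v
  proof (cases "v < n")
    case True
    then show ?thesis using code_inj[OF _ _ 1(1) True] assms(1,2) a b by auto
  next
    case False
    then have "f v = 0" "g v = 0" using assms(1,2) a b by force+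
    then show ?thesis by simp
  qed
  then show ?thesis using 2 3 a b by auto
qed

section \<open>Append-only queues without duplicates\<close>

definition insert_new :: "'a list \<Rightarrow> 'a \<Rightarrow> 'a list" where
  "insert_new q v = (if v \<in> set q then q else q @ [v])"

lemma foldl_insert_new:
  "set (foldl insert_new q vs) = set q \<union> set vs"
  "distinct q \<Longrightarrow> distinct (foldl insert_new q vs)"
  "\<exists>r. foldl insert_new q vs = q @ r"
proof -
  show "set (foldl insert_new q vs) = set q \<union> set vs"
    by (induction vs arbitrary: q) (auto simp: insert_new_def)
  show "distinct q \<Longrightarrow> distinct (foldl insert_new q vs)"
    by (induction vs arbitrary: q) (auto simp: insert_new_def)
  show "\<exists>r. foldl insert_new q vs = q @ r"
  proof (induction vs arbitrary: q)
    case (Cons v vs)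
    obtain r where "foldl insert_new (insert_new q v) vs = insert_new q v @ r" using Cons by blast
    moreover have "insert_new q v = q \<or> insert_new q v = q @ [v]" by (simp add: insert_new_def)
    ultimately show ?case by auto
  qed simp
qed

subsection \<open>The search\<close>

text \<open>Along with the digits of \<open>x\<close> in \<open>dig\<close>, the code of the state after the end of timestep \<open>t\<close> is
  computed in \<open>y\<close>: only vertices with a label above \<open>t\<close> contribute, and status \<open>2\<close> becomes \<open>1\<close>.\<close>

definition decode_step :: com where
  "decode_step = ''u'' :=: Sub (scalar ''u'') (Num 1) ;; ''g'' :=: Num 0 ;;
     (let digit = Cond (Less (scalar ''z'') (Get ''w'' (scalar ''u''))) Skip
        (''z'' :=: Sub (scalar ''z'') (Get ''w'' (scalar ''u'')) ;; increment ''g'')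
      in digit ;; digit ;; digit) ;;
     Put ''dig'' (scalar ''u'') (scalar ''g'') ;;
     Cond (Less (scalar ''t'') (Get ''last'' (scalar ''u'')))
       (Cond (Less (scalar ''g'') (Num 3))
          (Cond (Equal (scalar ''g'') (Num 0)) Skip
             (''y'' :=: Add (scalar ''y'') (Get ''w'' (scalar ''u''))))
          (''y'' :=: Add (scalar ''y'') (Add (Get ''w'' (scalar ''u''))
             (Add (Get ''w'' (scalar ''u'')) (Get ''w'' (scalar ''u''))))))
       Skip"

definition decode_prog :: com where
  "decode_prog = (''u'' :=: scalar ''n'' ;; ''z'' :=: scalar ''x'' ;; ''y'' :=: Num 0) ;;
     While (Less (Num 0) (scalar ''u'')) decode_step"

text \<open>\<open>mark\<close>, addressed by keys, answers the membership test in constant time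
  without a pass over the queue.\<close>

definition enqueue :: "aexp \<Rightarrow> aexp \<Rightarrow> aexp \<Rightarrow> aexp \<Rightarrow> com" where
  "enqueue a b c d = ''newkey'' :=: d ;;
     Cond (Equal (Get ''mark'' (scalar ''newkey'')) (Num 0))
       (Put ''mark'' (scalar ''newkey'') (Num 1) ;;
        Put ''qpos'' (scalar ''tail'') (Add (scalar ''pos'') (Num 1)) ;;
        Put ''qcode'' (scalar ''tail'') a ;; Put ''qburnt'' (scalar ''tail'') b ;;
        Put ''qsafe'' (scalar ''tail'') c ;; Put ''qkey'' (scalar ''tail'') (scalar ''newkey'') ;;
        increment ''tail'')
       Skip"

abbreviation weight_n :: aexp where "weight_n \<equiv> Get ''w'' (scalar ''n'')"
abbreviation weight_2n :: aexp where "weight_2n \<equiv> Get ''w'' (Add (scalar ''n'') (scalar ''n''))"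
abbreviation weight_3n :: aexp where
  "weight_3n \<equiv> Get ''w'' (Add (Add (scalar ''n'') (scalar ''n'')) (scalar ''n''))"
abbreviation weight_b :: aexp where "weight_b \<equiv> Get ''w'' (scalar ''b'')"

text \<open>Codes and keys are updated by differences: \<open>weight_3n\<close> advances the
  position, \<open>weight_n\<close> and \<open>weight_2n\<close> raise the counters, and two or
  three copies of \<open>weight_b\<close> write status 2 or 3 over 0. At an end marker the code
  \<open>x\<close> inside the key is exchanged for \<open>y\<close>.\<close>

definition expand :: com where
  "expand = Cond (Equal (scalar ''a'') (scalar ''b''))
     (enqueue (scalar ''y'') (scalar ''burnt'') (scalar ''safe'')
        (Add (Add (Sub (scalar ''key'') (scalar ''x'')) (scalar ''y'')) weight_3n))
     (Cond (Conj (Equal (Get ''dig'' (scalar ''a'')) (Num 1)) (Equal (Get ''dig'' (scalar ''b'')) (Num 0)))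
        (enqueue (Add (scalar ''x'') (Add weight_b weight_b)) (Add (scalar ''burnt'') (Num 1)) (scalar ''safe'')
           (Add (Add (scalar ''key'') (Add weight_b weight_b)) (Add weight_n weight_3n)) ;;
         Cond (Less (scalar ''safe'') (scalar ''t''))
           (enqueue (Add (scalar ''x'') (Add weight_b (Add weight_b weight_b))) (scalar ''burnt'')
              (Add (scalar ''safe'') (Num 1))
              (Add (Add (scalar ''key'') (Add weight_b (Add weight_b weight_b))) (Add weight_2n weight_3n)))
           Skip)
        (enqueue (scalar ''x'') (scalar ''burnt'') (scalar ''safe'') (Add (scalar ''key'') weight_3n)))"

definition visit :: com where
  "visit = (''pos'' :=: Get ''qpos'' (scalar ''head'') ;; ''x'' :=: Get ''qcode'' (scalar ''head'') ;;
      ''burnt'' :=: Get ''qburnt'' (scalar ''head'') ;; ''safe'' :=: Get ''qsafe'' (scalar ''head'') ;;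
      ''key'' :=: Get ''qkey'' (scalar ''head'')) ;;
     (Cond (Less (scalar ''pos'') (scalar ''ops''))
        ((''t'' :=: Get ''opT'' (scalar ''pos'') ;; ''a'' :=: Get ''opA'' (scalar ''pos'') ;;
          ''b'' :=: Get ''opB'' (scalar ''pos'')) ;; (decode_prog ;; expand))
        (Cond (Less (Sub (scalar ''n'') (scalar ''burnt'')) (scalar ''h'')) Skip (''out'' :=: Num 1)) ;;
      increment ''head'')"

definition search_prog :: com where
  "search_prog = (''head'' :=: Num 0 ;; ''tail'' :=: Num 1 ;; ''out'' :=: Num 0 ;;
      Put ''qpos'' (Num 0) (Num 0) ;; Put ''qcode'' (Num 0) (Get ''w'' (scalar ''root'')) ;;
      Put ''qburnt'' (Num 0) (Num 1) ;; Put ''qsafe'' (Num 0) (Num 0) ;;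
      Put ''qkey'' (Num 0) (Add (Get ''w'' (scalar ''root'')) weight_n) ;;
      Put ''mark'' (scalar ''qkey'') (Num 1)) ;;
     While (Less (scalar ''head'') (scalar ''tail'')) visit"

abbreviation queue_names :: "string set" where
  "queue_names \<equiv> {''newkey'', ''mark'', ''qpos'', ''qcode'', ''qburnt'', ''qsafe'', ''qkey'', ''tail''}"

lemma enqueue_simps [simp]: "loop_free (enqueue a b c d)"
  "modified (enqueue a b c d) = queue_names"
  "cost_bound (enqueue a b c d) = acost a + acost b + acost c + acost d + 40"
  by (auto simp: enqueue_def)

lemma decode_step_simps [simp]: "loop_free decode_step"
  "modified decode_step = {''u'', ''z'', ''g'', ''dig'', ''y''}"
  by (auto simp: decode_step_def Let_def)

lemma decode_step_cost: "cost_bound decode_step \<le> 150"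
  by (simp add: decode_step_def Let_def)

lemma modified_decode [simp]: "modified decode_prog = {''u'', ''z'', ''g'', ''dig'', ''y''}"
  by (auto simp: decode_prog_def)

lemma expand_simps [simp]: "loop_free expand" "cost_bound expand \<le> 400"
  "modified expand = queue_names"
  by (auto simp: expand_def)

definition represents_queue :: "nat \<Rightarrow> node list \<Rightarrow> store \<Rightarrow> bool" where
  "represents_queue n q s \<longleftrightarrow> s ''tail'' 0 = int (length q) \<and>
     (\<forall>i<length q. case q ! i of (k, f, x, y) \<Rightarrow> s ''qpos'' (int i) = int k \<and>
        s ''qcode'' (int i) = code f n \<and> s ''qburnt'' (int i) = int x \<and> s ''qsafe'' (int i) = int y \<and>
        s ''qkey'' (int i) = key n (q ! i)) \<and>
     (\<forall>z. s ''mark'' z = (if z \<in> key n ` set q then 1 else 0))"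

lemma represents_queue_cong:
  assumes "\<And>x. x \<in> {''tail'', ''qpos'', ''qcode'', ''qburnt'', ''qsafe'', ''qkey'', ''mark''} \<Longrightarrow> s' x = s x"
  shows "represents_queue n q s' \<longleftrightarrow> represents_queue n q s"
  using assms by (simp add: represents_queue_def)

text \<open>Injectivity of \<open>key\<close> on legal nodes turns the test of \<open>mark\<close>
  into a membership test. The premise \<open>stable\<close> accounts for the argument expressions
  being evaluated between the writes, when some queue arrays have already changed.\<close>

lemma represents_queue_enqueue:
  assumes "represents_queue n q s" "\<forall>v\<in>set q. legal n v" "legal n (Suc k, f, x, y)" "s ''pos'' 0 = int k"
    and stable: "\<And>s'. (\<And>x. x \<notin> queue_names \<Longrightarrow>
      s' x = s x) \<Longrightarrow> aval a s' = code f n \<and> aval b s' = int x \<and> aval c s' = int y \<and>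
        aval d s' = key n (Suc k, f, x, y)"
  shows "represents_queue n (insert_new q (Suc k, f, x, y)) (effect (enqueue a b c d) s)"
proof -
  let ?v = "(Suc k, f, x, y)"
  have d: "aval d s = key n ?v" using stable by blast
  have mark: "s ''mark'' (key n ?v) = 0 \<longleftrightarrow> ?v \<notin> set q"
  proof -
    have "w = ?v" if "w \<in> set q" "key n ?v = key n w" for w
      using key_inj[of n w ?v] assms(2,3) that by (simp del: key.simps legal.simps)
    then have "key n ?v \<in> key n ` set q \<longleftrightarrow> ?v \<in> set q" by blast
    then show ?thesis using assms(1) unfolding represents_queue_def by simp
  qed
  let ?s1 = "s(''newkey'' := (s ''newkey'')(0 := key n ?v))"
  show ?thesis
  proof (cases "?v \<in> set q")
    case True
    then have "effect (enqueue a b c d) s = ?s1"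
      using mark d by (simp add: enqueue_def del: key.simps)
    then show ?thesis using True assms(1) by (simp add: insert_new_def represents_queue_def)
  next
    case False
    let ?s2 = "?s1(''mark'' := (s ''mark'')(key n ?v := 1))"
    let ?l = "int (length q)"
    let ?s3 = "?s2(''qpos'' := (s ''qpos'')(?l := int k + 1))"
    let ?s4 = "?s3(''qcode'' := (s ''qcode'')(?l := code f n))"
    let ?s5 = "?s4(''qburnt'' := (s ''qburnt'')(?l := int x))"
    let ?s6 = "?s5(''qsafe'' := (s ''qsafe'')(?l := int y))"
    let ?s7 = "?s6(''qkey'' := (s ''qkey'')(?l := key n ?v))"
    let ?s8 = "?s7(''tail'' := (s ''tail'')(0 := ?l + 1))"
    have l: "s ''tail'' 0 = ?l" using assms(1) by (simp add: represents_queue_def)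
    have "aval a ?s3 = code f n" "aval b ?s4 = int x" "aval c ?s5 = int y"
      using stable by (simp_all del: key.simps)
    then have "effect (enqueue a b c d) s = ?s8"
      using False mark d l assms(4) by (simp add: enqueue_def del: key.simps)
    then show ?thesis using False assms(1)
      by (auto simp: insert_new_def represents_queue_def nth_append less_Suc_eq simp del: key.simps
          split: prod.splits)
  qed
qed

text \<open>Since \<open>c < M\<close>, exactly \<open>k\<close> of the three conditional
  subtractions of \<open>M\<close> fire; the digit is found without division.\<close>

lemma effect_decode_step:
  assumes "s ''u'' 0 = int m + 1" "s ''z'' 0 = c + int k * M" "0 \<le> c" "c < M" "k < 4"
    "s ''w'' (int m) = M"
  shows "effect decode_step s ''u'' 0 = int m" "effect decode_step s ''z'' 0 = c"
    "effect decode_step s ''dig'' = (s ''dig'')(int m := int k)"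
    "effect decode_step s ''y'' 0 = s ''y'' 0 +
      (if s ''t'' 0 < s ''last'' (int m) then int (if k = 2 then 1 else k) * M else 0)"
proof -
  have "k = 0 \<or> k = 1 \<or> k = 2 \<or> k = 3" using assms(5) by linarith
  then show "effect decode_step s ''u'' 0 = int m" "effect decode_step s ''z'' 0 = c"
    "effect decode_step s ''dig'' = (s ''dig'')(int m := int k)"
    "effect decode_step s ''y'' 0 = s ''y'' 0 +
      (if s ''t'' 0 < s ''last'' (int m) then int (if k = 2 then 1 else k) * M else 0)"
    using assms by (elim disjE; simp add: decode_step_def Let_def)+
qed

context firefighter_input
begin

definition forget :: "nat \<Rightarrow> (nat \<Rightarrow> nat) \<Rightarrow> nat \<Rightarrow> nat" where
  "forget t f = (\<lambda>v. if later t v then (if f v = 2 then 1 else f v) else 0)"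

text \<open>Digits are extracted from the highest to the lowest, so the rest in \<open>z\<close> is
  always a shorter code, while \<open>y\<close> collects the upper part of the code of
  \<open>forget t f\<close>.\<close>

lemma runs_decode:
  assumes w: "\<forall>k\<le>3 * n. s0 ''w'' (int k) = 4 ^ k" and n: "s0 ''n'' 0 = int n"
    and x: "s0 ''x'' 0 = code f n" and f: "\<And>v. f v < 4" and t: "s0 ''t'' 0 = int t"
    and last: "\<And>v t. int t < s0 ''last'' (int v) \<longleftrightarrow> later t v"
  shows "runs decode_prog s0 (200 * (n + 1))
    (\<lambda>s. (\<forall>v<n. s ''dig'' (int v) = int (f v)) \<and> s ''y'' 0 = code (forget t f) n)"
proof -
  let ?I = "\<lambda>i s. i \<le> n \<and> s ''u'' 0 = int (n - i) \<and> s ''z'' 0 = code f (n - i) \<and>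
    (\<forall>v<n. n - i \<le> v \<longrightarrow> s ''dig'' (int v) = int (f v)) \<and>
    s ''y'' 0 = code (forget t f) n - code (forget t f) (n - i)"
  show ?thesis unfolding decode_prog_def
  proof (rule runs_init_While_loop_free[where I = ?I and N = n], goal_cases)
    case (4 i s)
    define m where "m = n - Suc i"
    have i: "i < n" using 4 by auto
    then have m: "n - i = Suc m" "n - Suc i = m" "m < n" by (auto simp: m_def)
    have s: "s ''u'' 0 = int m + 1" "s ''z'' 0 = code f m + int (f m) * 4 ^ m"
      using 4(1) m by (simp_all add: code_Suc)
    have "s ''w'' = s0 ''w''" "s ''t'' = s0 ''t''" "s ''last'' = s0 ''last''" using 4(2) by simp_all
    then have wm: "s ''w'' (int m) = 4 ^ m"
      and l: "s ''t'' 0 < s ''last'' (int m) \<longleftrightarrow> later t m" using w m t last by simp_all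
    note e = effect_decode_step[OF s code_bounds[OF f] f wm]
    have "effect decode_step s ''y'' 0 = code (forget t f) n - code (forget t f) m"
      using e(4) l 4(1) m by (auto simp: code_Suc forget_def)
    moreover have "effect decode_step s ''dig'' (int v) = int (f v)" if "v < n" "m \<le> v" for v
      using e(3) 4(1) m that by (cases "v = m") auto
    ultimately show ?case using e(1,2) i m(2) by simp
  next
    case 6
    have "n * cost_bound decode_step \<le> n * 150"
      by (rule mult_left_mono[OF decode_step_cost]) simp
    then have "n * cost_bound decode_step \<le> 184 + n * 195" by linarith
    then show ?case by (simp add: algebra_simps)
  qed (use n x in auto)
qed

lemma represents_queue_expand:
  assumes q: "represents_queue n q s" "\<forall>v\<in>set q. legal n v"
    and succs: "\<forall>v\<in>Pair (Suc k) ` set (branches later (a, b, t) (f, x, y)). legal n v"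
    and s: "s ''pos'' 0 = int k" "s ''a'' 0 = int a" "s ''b'' 0 = int b" "s ''t'' 0 = int t"
      "s ''x'' 0 = code f n" "s ''burnt'' 0 = int x" "s ''safe'' 0 = int y"
      "s ''key'' 0 = key n (k, f, x, y)" "s ''y'' 0 = code (forget t f) n" "s ''n'' 0 = int n"
      "s ''dig'' (int a) = int (f a)" "s ''dig'' (int b) = int (f b)"
    and b: "b < n" and w: "\<forall>k\<le>3 * n. s ''w'' (int k) = 4 ^ k"
  shows "represents_queue n (foldl insert_new q (map (Pair (Suc k)) (branches later (a, b, t) (f, x, y))))
    (effect expand s)"
proof -
  have wn: "s ''w'' (int n) = 4 ^ n" "s ''w'' (int n + int n) = 4 ^ (n + n)"
    "s ''w'' (int n + int n + int n) = 4 ^ (n + n + n)" "s ''w'' (int b) = 4 ^ b"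
    using w[rule_format, of n] w[rule_format, of "n + n"] w[rule_format, of "n + n + n"]
      w[rule_format, of b] b by (simp_all del: power_add)
  consider "a = b" | "a \<noteq> b" "f a = 1 \<and> f b = 0" | "a \<noteq> b" "\<not> (f a = 1 \<and> f b = 0)" by blast
  then show ?thesis
  proof cases
    case 1
    have "represents_queue n (insert_new q (Suc k, forget t f, x, y)) (effect (enqueue (scalar ''y'') (scalar ''burnt'') (scalar ''safe'')
        (Add (Add (Sub (scalar ''key'') (scalar ''x'')) (scalar ''y'')) weight_3n)) s)"
    proof (rule represents_queue_enqueue[OF q _ s(1)])
      show "legal n (Suc k, forget t f, x, y)" using succs 1 by (simp add: forget_def)
    qed (use s wn in \<open>auto simp: algebra_simps simp del: power_add\<close>)
    then show ?thesis using 1 s by (simp add: expand_def forget_def)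
  next
    case 2
    let ?e1 = "enqueue (Add (scalar ''x'') (Add weight_b weight_b)) (Add (scalar ''burnt'') (Num 1)) (scalar ''safe'')
           (Add (Add (scalar ''key'') (Add weight_b weight_b)) (Add weight_n weight_3n))"
    let ?e2 = "enqueue (Add (scalar ''x'') (Add weight_b (Add weight_b weight_b))) (scalar ''burnt'')
              (Add (scalar ''safe'') (Num 1))
              (Add (Add (scalar ''key'') (Add weight_b (Add weight_b weight_b))) (Add weight_2n weight_3n))"
    let ?s1 = "effect ?e1 s"
    have leg1: "legal n (Suc k, f(b := 2), x + 1, y)" using succs 2 by (simp del: legal.simps)
    have q1: "represents_queue n (insert_new q (Suc k, f(b := 2), x + 1, y)) ?s1"
      by (rule represents_queue_enqueue[OF q leg1 s(1)])
        (use s wn 2 b in \<open>auto simp: algebra_simps code_upd simp del: power_add\<close>)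
    \<comment> \<open>The registers read by the second \<open>enqueue\<close> lie outside the queue
      arrays and survive the first.\<close>
    have f1: "?s1 z = s z" if "z \<notin> queue_names" for z using that by (intro effect_frame) simp
    have s1: "?s1 ''safe'' 0 = int y" "?s1 ''t'' 0 = int t" using f1 s by simp_all
    have ex: "effect expand s = (if y < t then effect ?e2 ?s1 else ?s1)"
      using 2 s s1 by (simp add: expand_def)
    show ?thesis
    proof (cases "y < t")
      case False
      then show ?thesis using ex q1 2 by simp
    next
      case True
      have leg2: "legal n (Suc k, f(b := 3), x, y + 1)" using succs 2 True by (simp del: legal.simps)
      have "represents_queue n (insert_new (insert_new q (Suc k, f(b := 2), x + 1, y)) (Suc k, f(b := 3), x, y + 1))
        (effect ?e2 ?s1)"
      proof (rule represents_queue_enqueue[OF q1 _ leg2])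
        show "\<forall>v\<in>set (insert_new q (Suc k, f(b := 2), x + 1, y)). legal n v"
          using q(2) leg1 by (simp add: insert_new_def del: legal.simps)
      qed (use f1 s wn 2 b in \<open>auto simp: algebra_simps code_upd simp del: power_add\<close>)
      then show ?thesis using ex 2 True by simp
    qed
  next
    case 3
    have "represents_queue n (insert_new q (Suc k, f, x, y))
      (effect (enqueue (scalar ''x'') (scalar ''burnt'') (scalar ''safe'') (Add (scalar ''key'') weight_3n)) s)"
    proof (rule represents_queue_enqueue[OF q _ s(1)])
      show "legal n (Suc k, f, x, y)" using succs 3 by (auto simp del: legal.simps)
    qed (use s wn in \<open>auto simp: algebra_simps simp del: power_add\<close>)
    moreover have "effect expand s =
      effect (enqueue (scalar ''x'') (scalar ''burnt'') (scalar ''safe'') (Add (scalar ''key'') weight_3n)) s"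
      using 3 s by (auto simp: expand_def)
    moreover have "branches later (a, b, t) (f, x, y) = [(f, x, y)]" using 3 by auto
    ultimately show ?thesis by simp
  qed
qed

section \<open>The layered graph explored by the search\<close>

abbreviation ops :: "(nat \<times> nat \<times> nat) list" where "ops \<equiv> schedule (lifetime G)"

definition nodes :: "node set" where
  "nodes = {(k, z). k \<le> length ops \<and> z \<in> reached k}"

definition successors :: "node \<Rightarrow> node list" where
  "successors v = (if fst v < length ops
     then map (Pair (Suc (fst v))) (branches later (ops ! fst v) (snd v)) else [])"

fun accepting :: "int \<Rightarrow> node \<Rightarrow> bool" where
  "accepting h (k, f, x, y) \<longleftrightarrow> k = length ops \<and> h \<le> int n - int x"

lemma legal_nodes: "v \<in> nodes \<Longrightarrow> legal n v"
  using reached_counts reached_statuses by (cases v) (fastforce simp: nodes_def)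

lemma successors_nodes: "v \<in> nodes \<Longrightarrow> set (successors v) \<subseteq> nodes"
  by (auto simp: nodes_def successors_def reached_Suc)

lemma start_nodes: "(0, start) \<in> nodes"
  by (simp add: nodes_def reached_0)

text \<open>By induction on the layer, since each state of \<open>reached (Suc k)\<close> is a
  branch of one in \<open>reached k\<close>. Hence a worklist whose entries have all been processed
  has found every node.\<close>

lemma nodes_closure:
  assumes "(0, start) \<in> A" "\<And>v. v \<in> A \<Longrightarrow> set (successors v) \<subseteq> A" shows "nodes \<subseteq> A"
proof -
  have "k \<le> length ops \<Longrightarrow> z \<in> reached k \<Longrightarrow> (k, z) \<in> A" for k z
  proof (induction k arbitrary: z)
    case (Suc k)
    then obtain z' where z': "z' \<in> reached k" "z \<in> set (branches later (ops ! k) z')"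
      by (auto simp: reached_Suc)
    then have "(k, z') \<in> A" using Suc by simp
    from assms(2)[OF this] show ?case using z' Suc.prems by (auto simp: successors_def)
  qed (use assms in \<open>simp add: reached_0\<close>)
  then show ?thesis by (auto simp: nodes_def)
qed

lemma card_nodes: "finite nodes" "card nodes \<le> (length ops + 1) * (4 ^ (vim_width G + 1) * (n + 1) ^ 2)"
proof -
  have eq: "nodes = Sigma {..length ops} reached" by (auto simp: nodes_def)
  show "finite nodes" unfolding eq using card_reached(1) by simp
  have "card nodes = (\<Sum>k\<le>length ops. card (reached k))" unfolding eq by (rule card_SigmaI) (use card_reached(1) in auto)
  also have "\<dots> \<le> (\<Sum>k\<le>length ops. 4 ^ (vim_width G + 1) * (n + 1) ^ 2)"
    by (rule sum_mono) (rule card_reached(2))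
  finally show "card nodes \<le> (length ops + 1) * (4 ^ (vim_width G + 1) * (n + 1) ^ 2)" by simp
qed

text \<open>The queue is never shortened: \<open>i\<close> separates the processed entries from the
  waiting ones, so at the end the list itself is the set of all nodes.\<close>

definition search_state :: "int \<Rightarrow> nat \<Rightarrow> node list \<Rightarrow> store \<Rightarrow> bool" where
  "search_state h i q s \<longleftrightarrow> i \<le> length q \<and> s ''head'' 0 = int i \<and> represents_queue n q s \<and>
     distinct q \<and> set q \<subseteq> nodes \<and> (0, start) \<in> set q \<and> (\<forall>j<i. set (successors (q ! j)) \<subseteq> set q) \<and>
     s ''out'' 0 = (if \<exists>j<i. accepting h (q ! j) then 1 else 0)"

fun search_input :: "int \<Rightarrow> store \<Rightarrow> bool" where
  "search_input h s \<longleftrightarrow> s ''n'' 0 = int n \<and> s ''h'' 0 = h \<and> (\<forall>k\<le>3 * n. s ''w'' (int k) = 4 ^ k) \<and>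
     (\<forall>v t. int t < s ''last'' (int v) \<longleftrightarrow> later t v) \<and> represents_ops ops s"

lemma modified_visit [simp]: "modified visit =
  {''pos'', ''x'', ''burnt'', ''safe'', ''key'', ''t'', ''a'', ''b'', ''u'', ''z'', ''g'', ''dig'', ''y'',
    ''out'', ''head''} \<union> queue_names"
  by (auto simp: visit_def)

lemma runs_visit:
  assumes inv: "search_state h i q s" and i: "i < length q" and inp: "search_input h s"
  shows "runs visit s (200 * (n + 1) + 600)
    (search_state h (Suc i) (foldl insert_new q (successors (q ! i))))"
proof -
  obtain k f x y where v: "q ! i = (k, f, x, y)" by (cases "q ! i") auto
  let ?q' = "foldl insert_new q (successors (q ! i))"
  have "set q \<subseteq> nodes" using inv unfolding search_state_def by blast
  then have mem: "(k, f, x, y) \<in> nodes" using nth_mem[OF i] v by auto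
  have leg: "\<forall>v\<in>set q. legal n v" using inv legal_nodes unfolding search_state_def by blast
  have kle: "k \<le> length ops" using mem by (simp add: nodes_def)
  let ?pop = "''pos'' :=: Get ''qpos'' (scalar ''head'') ;; ''x'' :=: Get ''qcode'' (scalar ''head'') ;;
      ''burnt'' :=: Get ''qburnt'' (scalar ''head'') ;; ''safe'' :=: Get ''qsafe'' (scalar ''head'') ;;
      ''key'' :=: Get ''qkey'' (scalar ''head'')"
  let ?load = "''t'' :=: Get ''opT'' (scalar ''pos'') ;; ''a'' :=: Get ''opA'' (scalar ''pos'') ;;
          ''b'' :=: Get ''opB'' (scalar ''pos'')"
  define s1 where "s1 = effect ?pop s"
  have s: "s ''head'' 0 = int i" "s ''qpos'' (int i) = int k" "s ''qcode'' (int i) = code f n"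
    "s ''qburnt'' (int i) = int x" "s ''qsafe'' (int i) = int y" "s ''qkey'' (int i) = key n (k, f, x, y)"
    using inv i v unfolding search_state_def represents_queue_def by auto
  have val1: "s1 ''pos'' 0 = int k" "s1 ''x'' 0 = code f n" "s1 ''burnt'' 0 = int x"
    "s1 ''safe'' 0 = int y" "s1 ''key'' 0 = key n (k, f, x, y)"
    using s by (simp_all add: s1_def del: key.simps)
  have f1: "s1 z = s z" if "z \<notin> {''pos'', ''x'', ''burnt'', ''safe'', ''key''}" for z
    unfolding s1_def using that by (intro effect_frame) simp
  have rq1: "represents_queue n q s1"
  proof (rule iffD2[OF represents_queue_cong])
    show "represents_queue n q s" using inv unfolding search_state_def by blast
  qed (rule f1, auto)
  have out: "s ''out'' 0 = (if \<exists>j<i. accepting h (q ! j) then 1 else 0)"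
    using inv unfolding search_state_def by blast
  have n: "s ''n'' 0 = int n" "s ''h'' 0 = h" "s ''ops'' 0 = int (length ops)"
    using inp by (auto simp: represents_ops_def)
  have step: "runs (Cond (Less (scalar ''pos'') (scalar ''ops''))
        (?load ;; (decode_prog ;; expand))
        (Cond (Less (Sub (scalar ''n'') (scalar ''burnt'')) (scalar ''h'')) Skip (''out'' :=: Num 1))) s1
      (200 * (n + 1) + 500) (\<lambda>s'. represents_queue n ?q' s' \<and>
        s' ''out'' 0 = (if \<exists>j<Suc i. accepting h (q ! j) then 1 else 0))"
  proof (rule runs_Cond[where k = "200 * (n + 1) + 450"], goal_cases)
    case 1
    then have k: "k < length ops" using val1 f1 n by simp
    obtain a b t where op: "ops ! k = (a, b, t)" by (cases "ops ! k")
    have "(a, b, t) \<in> set ops" using k op nth_mem by metis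
    then have ab: "a < n" "b < n" using schedule_less by auto
    define s2 where "s2 = effect ?load s1"
    have "s ''opT'' (int k) = int t" "s ''opA'' (int k) = int a" "s ''opB'' (int k) = int b"
      using inp k op unfolding search_input.simps represents_ops_def by auto
    then have val2: "s2 ''t'' 0 = int t" "s2 ''a'' 0 = int a" "s2 ''b'' 0 = int b"
      using val1(1) f1 by (simp_all add: s2_def)
    have f2: "s2 z = s1 z" if "z \<notin> {''t'', ''a'', ''b''}" for z
      unfolding s2_def using that by (intro effect_frame) simp
    show ?case
    proof (rule runs_Seq_loop_free[where l = "200 * (n + 1) + 400"])
      show "runs (decode_prog ;; expand) (effect ?load s1) (200 * (n + 1) + 400) (\<lambda>s'. represents_queue n ?q' s' \<and>
        s' ''out'' 0 = (if \<exists>j<Suc i. accepting h (q ! j) then 1 else 0))"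
        unfolding s2_def[symmetric]
      proof (rule runs_Seq[OF runs_decode[where f = f and t = t], rotated 6])
        fix s3
        assume dec: "(\<forall>v<n. s3 ''dig'' (int v) = int (f v)) \<and> s3 ''y'' 0 = code (forget t f) n"
          and f3: "\<And>x. x \<notin> modified decode_prog \<Longrightarrow> s3 x = s2 x"
        have f31: "s3 z = s1 z" if "z \<notin> {''t'', ''a'', ''b'', ''u'', ''z'', ''g'', ''dig'', ''y''}" for z
          using f3 f2 that by simp
        have s3: "s3 ''t'' 0 = int t" "s3 ''a'' 0 = int a" "s3 ''b'' 0 = int b"
          "s3 ''pos'' 0 = int k" "s3 ''x'' 0 = code f n" "s3 ''burnt'' 0 = int x"
          "s3 ''safe'' 0 = int y" "s3 ''key'' 0 = key n (k, f, x, y)"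
          "s3 ''n'' 0 = int n" "s3 ''w'' = s ''w''" "s3 ''out'' = s ''out''"
          using f3 val2 f31 val1 f1 n by (simp_all del: key.simps)
        have succ: "successors (q ! i) = map (Pair (Suc k)) (branches later (a, b, t) (f, x, y))"
          using v k op by (simp add: successors_def)
        have "represents_queue n q s3"
          by (rule iffD2[OF represents_queue_cong rq1], rule f31) auto
        moreover have "\<forall>v\<in>Pair (Suc k) ` set (branches later (a, b, t) (f, x, y)). legal n v"
          using successors_nodes[OF mem] legal_nodes unfolding v[symmetric] succ set_map by blast
        ultimately have "represents_queue n ?q' (effect expand s3)"
          unfolding succ
          by (intro represents_queue_expand[OF _ leg]) (use s3 dec ab inp in simp_all)
        moreover have "effect expand s3 ''out'' = s ''out''" using s3 effect_frame[of "''out''" expand] by simp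
        \<comment> \<open>A node before the last layer is never accepting, so the flag needs no
          update.\<close>
        moreover have "(\<exists>j<Suc i. accepting h (q ! j)) \<longleftrightarrow> (\<exists>j<i. accepting h (q ! j))"
          using v k by (auto simp: less_Suc_eq)
        ultimately show "runs expand s3 400 (\<lambda>s'. represents_queue n ?q' s' \<and>
            s' ''out'' 0 = (if \<exists>j<Suc i. accepting h (q ! j) then 1 else 0))"
          using out by (intro runs_loop_free) simp_all
      next
        show "f v < 4" for v using legal_nodes[OF mem] by simp
        have l: "s2 ''last'' = s ''last''" using f2 f1 by simp
        show "int t' < s2 ''last'' (int v) \<longleftrightarrow> later t' v" for v t'
          unfolding l using inp unfolding search_input.simps by blast
      qed (use val2 f2 f1 val1 inp in simp_all)
    qed simp_all
  next
    case 2
    then have "k = length ops" using val1 f1 n kle by simp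
    then have "successors (q ! i) = []" "accepting h (q ! i) \<longleftrightarrow> h \<le> int n - int x"
      using v by (auto simp: successors_def)
    moreover have "(\<exists>j<Suc i. accepting h (q ! j)) \<longleftrightarrow> (\<exists>j<i. accepting h (q ! j)) \<or> accepting h (q ! i)"
      by (auto simp: less_Suc_eq)
    moreover have "represents_queue n q (s1(''out'' := g))" for g
      by (rule iffD2[OF represents_queue_cong rq1]) auto
    ultimately show ?case using rq1 out n val1 f1
      by (intro runs_loop_free) (auto simp del: accepting.simps)
  qed simp
  show ?thesis unfolding visit_def
  proof (rule runs_Seq_loop_free[where l = "200 * (n + 1) + 510", OF _ runs_Seq[OF step[unfolded s1_def], where l = 10]], goal_cases)
    case (2 s')
    obtain r where r: "?q' = q @ r" using foldl_insert_new(3) by blast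
    have "s' ''head'' = s1 ''head''" using 2(2) by (simp add: s1_def)
    then have hd: "s' ''head'' 0 = int i" using f1 s by simp
    \<comment> \<open>New nodes are only appended, so processed entries keep their index.\<close>
    have nth: "j < Suc i \<Longrightarrow> ?q' ! j = q ! j" for j using i r by (simp add: nth_append)
    have rq: "represents_queue n ?q' (effect (increment ''head'') s')"
      by (rule iffD2[OF represents_queue_cong conjunct1[OF 2(1)]]) auto
    have "set (successors (?q' ! j)) \<subseteq> set ?q'" if "j < Suc i" for j
    proof (cases "j = i")
      case True
      then have "?q' ! j = q ! i" using nth[OF that] by simp
      then show ?thesis by (simp only: foldl_insert_new(1)) blast
    next
      case False
      then have "set (successors (q ! j)) \<subseteq> set q" using that inv unfolding search_state_def by auto
      moreover have "?q' ! j = q ! j" by (rule nth[OF that])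
      ultimately show ?thesis by (simp only: foldl_insert_new(1)) blast
    qed
    moreover have "set (successors (q ! i)) \<subseteq> nodes" using successors_nodes mem v by simp
    moreover have "distinct ?q'" using foldl_insert_new(2) inv unfolding search_state_def by blast
    moreover have "(\<exists>j<Suc i. accepting h (?q' ! j)) \<longleftrightarrow> (\<exists>j<Suc i. accepting h (q ! j))" using nth by auto
    moreover have "set q \<subseteq> nodes" "(0, start) \<in> set q" using inv unfolding search_state_def by auto
    moreover have "set ?q' \<subseteq> nodes"
      using \<open>set (successors (q ! i)) \<subseteq> nodes\<close> \<open>set q \<subseteq> nodes\<close> by (simp only: foldl_insert_new(1)) blast
    ultimately have "search_state h (Suc i) ?q' (effect (increment ''head'') s')"
      unfolding search_state_def using rq hd 2(1) i r
      by (simp add: foldl_insert_new(1) del: accepting.simps)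
    then show ?case by (intro runs_loop_free) simp_all
  qed simp_all
qed

lemma runs_search:
  assumes "search_input h s0" "s0 ''root'' 0 = int r" "s0 ''mark'' = (\<lambda>_. 0)"
  shows "runs search_prog s0 ((card nodes + 1) * (200 * (n + 1) + 700))
    (\<lambda>s. s ''out'' 0 = (if temporal_firefighter G r h then 1 else 0))"
proof -
  let ?init = "''head'' :=: Num 0 ;; ''tail'' :=: Num 1 ;; ''out'' :=: Num 0 ;;
      Put ''qpos'' (Num 0) (Num 0) ;; Put ''qcode'' (Num 0) (Get ''w'' (scalar ''root'')) ;;
      Put ''qburnt'' (Num 0) (Num 1) ;; Put ''qsafe'' (Num 0) (Num 0) ;;
      Put ''qkey'' (Num 0) (Add (Get ''w'' (scalar ''root'')) weight_n) ;;
      Put ''mark'' (scalar ''qkey'') (Num 1)"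
  have code: "code ((\<lambda>_. 0)(r := 1)) n = 4 ^ r"
    using code_upd[OF root_less, of "\<lambda>_. 0" 1] by (simp add: code_def)
  have w: "s0 ''w'' (int r) = 4 ^ r" "s0 ''w'' (int n) = 4 ^ n"
    using assms(1) root_less by simp_all
  have init: "search_state h 0 [(0, start)] (effect ?init s0)"
    using start_nodes assms w code by (auto simp: search_state_def represents_queue_def start_def)
  show ?thesis unfolding search_prog_def
  proof (rule runs_init_While[where I = "\<lambda>i s. \<exists>q. search_state h i q s" and N = "card nodes"
        and k = "200 * (n + 1) + 600"], goal_cases)
    case 2
    then show ?case using init by blast
  next
    case (3 i s)
    then obtain q where q: "search_state h i q s" by blast
    then have len: "i < length q" using 3(3) by (simp add: search_state_def represents_queue_def)
    \<comment> \<open>The queue is a duplicate-free list of nodes; this bounds the number of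
      iterations.\<close>
    have "length q \<le> card nodes"
      using q card_mono[OF card_nodes(1), of "set q"] distinct_card[of q] unfolding search_state_def by auto
    moreover have fr: "s z = s0 z" if "z \<in> {''n'', ''h'', ''w'', ''last'', ''opA'', ''opB'', ''opT'', ''ops''}" for z
      by (rule 3(2)) (use that in auto)
    moreover have "search_input h s"
      using assms(1) fr represents_ops_cong[of s s0 ops] by simp
    ultimately show ?case using runs_visit[OF q len] len by (auto elim!: runs_mono)
  next
    case (4 i s)
    then obtain q where q: "search_state h i q s" by blast
    then have i: "i = length q" using 4(3) by (simp add: search_state_def represents_queue_def)
    have qf: "set q \<subseteq> nodes" "(0, start) \<in> set q"
      "\<forall>j<i. set (successors (q ! j)) \<subseteq> set q"
      "s ''out'' 0 = (if \<exists>j<i. accepting h (q ! j) then 1 else 0)"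
      using q unfolding search_state_def by - (elim conjE, assumption)+
    have "set (successors v) \<subseteq> set q" if v: "v \<in> set q" for v
    proof -
      obtain j where "j < length q" "q ! j = v" using v unfolding in_set_conv_nth by (elim exE conjE)
      then show ?thesis using qf(3) i by blast
    qed
    with qf(2) have "nodes \<subseteq> set q" by (rule nodes_closure)
    then have eq: "set q = nodes" using qf(1) by blast
    have "(\<exists>j<i. accepting h (q ! j)) \<longleftrightarrow> (\<exists>v\<in>set q. accepting h v)"
      unfolding i by (metis in_set_conv_nth)
    also have "\<dots> \<longleftrightarrow> temporal_firefighter G r h"
      unfolding eq firefighter_iff_reached by (auto simp: nodes_def)
    finally show ?case using qf(4) by simp
  qed (simp_all add: algebra_simps)
qed

end

section \<open>Assembly of the stages and the time bound\<close>

definition firefighter_prog :: com where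
  "firefighter_prog = weights_prog ;; owners_prog ;; lifetime_prog ;; rows_prog ;; active_prog ;;
     schedule_prog ;; search_prog"

lemma arr_nth: "i < length xs \<Longrightarrow> arr xs (int i) = xs ! i"
  by (simp add: arr_def)

context firefighter_input
begin

lemma input_store_ok: "input_ok (input_store n es r h)"
  by (auto simp: input_store_def arr_nth arr_def src_def dst_def labs_def split: prod.splits)

lemma input_store_lab:
  assumes "i < length occurrences"
  shows "input_store n es r h ''lab'' (int i) = int (snd (occurrences ! i))"
proof -
  have "concat (map (\<lambda>(u, v, ts). map int ts) es) =
      concat (map (\<lambda>(u, v, ts). map int ts) (map (nth es) [0..<length es]))"
    by (simp only: map_nth)
  also have "\<dots> = concat (map (\<lambda>e. map int (labs e)) [0..<length es])"
    by (simp add: labs_def case_prod_unfold comp_def)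
  also have "\<dots> = map (\<lambda>p. int (snd p)) occurrences"
    by (simp add: occurrences_upto_def map_concat comp_def)
  finally show ?thesis using assms by (simp add: input_store_def arr_nth)
qed

lemma input_ok_cong:
  assumes "\<And>x. x \<in> {''n'', ''root'', ''m'', ''src'', ''dst'', ''len''} \<Longrightarrow> s' x = s x"
  shows "input_ok s' \<longleftrightarrow> input_ok s"
  using assms by simp

definition total_bound :: nat where
  "total_bound = 200 * (n + 1) + (100 * (n ^ 2 * (lifetime G + 3) + 1) + (40 * (length occurrences + 1) +
     (40 * (length es + 1) + (100 * (length occurrences + 1) + (300 * (lifetime G * (length es + 1) + 1) +
     (card nodes + 1) * (200 * (n + 1) + 700))))))"

lemma runs_firefighter:
  "runs firefighter_prog (input_store n es r h) total_bound
    (\<lambda>s. s ''out'' 0 = (if temporal_firefighter G r h then 1 else 0))"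
  unfolding firefighter_prog_def total_bound_def
proof (rule runs_Seq[OF runs_weights[OF input_store_ok] _ order_refl])
  let ?s0 = "input_store n es r h"
  have zero: "?s0 x = (\<lambda>_. 0)" if "x \<in> {''act'', ''last'', ''mark''}" for x
    using that by (auto simp: input_store_def)
  have s0h: "?s0 ''h'' 0 = h" by (simp add: input_store_def arr_def)
  fix s1 assume w1: "\<forall>k\<le>3 * n. s1 ''w'' (int k) = 4 ^ k"
    and f1: "\<And>x. x \<notin> modified weights_prog \<Longrightarrow> s1 x = ?s0 x"
  have ok1: "input_ok s1" by (rule iffD2[OF input_ok_cong input_store_ok], rule f1) auto
  show "runs (owners_prog ;; lifetime_prog ;; rows_prog ;; active_prog ;; schedule_prog ;; search_prog) s1
     (100 * (n ^ 2 * (lifetime G + 3) + 1) + (40 * (length occurrences + 1) +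
     (40 * (length es + 1) + (100 * (length occurrences + 1) + (300 * (lifetime G * (length es + 1) + 1) +
     (card nodes + 1) * (200 * (n + 1) + 700))))))
     (\<lambda>s. s ''out'' 0 = (if temporal_firefighter G r h then 1 else 0))"
  proof (rule runs_Seq[OF runs_owners[OF ok1] _ order_refl])
    fix s2 assume p2: "s2 ''p'' 0 = int (length occurrences) \<and>
        (\<forall>i<length occurrences. s2 ''owner'' (int i) = int (fst (occurrences ! i)))"
      and f2: "\<And>x. x \<notin> modified owners_prog \<Longrightarrow> s2 x = s1 x"
    have ok2: "input_ok s2" by (rule iffD2[OF input_ok_cong ok1], rule f2) auto
    have lab2: "\<forall>i<length occurrences. s2 ''lab'' (int i) = int (snd (occurrences ! i))"
      using f1 f2 input_store_lab by simp
    show "runs (lifetime_prog ;; rows_prog ;; active_prog ;; schedule_prog ;; search_prog) s2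
       (40 * (length occurrences + 1) +
       (40 * (length es + 1) + (100 * (length occurrences + 1) + (300 * (lifetime G * (length es + 1) + 1) +
       (card nodes + 1) * (200 * (n + 1) + 700)))))
       (\<lambda>s. s ''out'' 0 = (if temporal_firefighter G r h then 1 else 0))"
    proof (rule runs_Seq[OF runs_lifetime[OF conjunct1[OF p2] lab2] _ order_refl])
      fix s3 assume l3: "s3 ''life'' 0 = int (lifetime G)"
        and f3: "\<And>x. x \<notin> modified lifetime_prog \<Longrightarrow> s3 x = s2 x"
      have ok3: "input_ok s3" by (rule iffD2[OF input_ok_cong ok2], rule f3) auto
      show "runs (rows_prog ;; active_prog ;; schedule_prog ;; search_prog) s3
         (40 * (length es + 1) + (100 * (length occurrences + 1) + (300 * (lifetime G * (length es + 1) + 1) +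
         (card nodes + 1) * (200 * (n + 1) + 700))))
         (\<lambda>s. s ''out'' 0 = (if temporal_firefighter G r h then 1 else 0))"
      proof (rule runs_Seq[OF runs_rows[OF ok3 l3] _ order_refl])
        fix s4 assume r4: "\<forall>e\<le>length es. s4 ''row'' (int e) = int (e * (lifetime G + 1))"
          and f4: "\<And>x. x \<notin> modified rows_prog \<Longrightarrow> s4 x = s3 x"
        have ok4: "input_ok s4" by (rule iffD2[OF input_ok_cong ok3], rule f4) auto
        have eq4: "s4 x = s2 x" if "x \<notin> {''e'', ''row'', ''life'', ''i''}" for x
          using f3[of x] f4[of x] that by simp
        have act4: "s4 ''act'' = (\<lambda>_. 0)" "s4 ''last'' = (\<lambda>_. 0)"
          using eq4 f2 f1 zero by simp_all
        have p4: "s4 ''p'' 0 = int (length occurrences)"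
            "\<forall>i<length occurrences. s4 ''lab'' (int i) = int (snd (occurrences ! i))"
            "\<forall>i<length occurrences. s4 ''owner'' (int i) = int (fst (occurrences ! i))"
          using eq4 p2 lab2 by simp_all
        show "runs (active_prog ;; schedule_prog ;; search_prog) s4
           (100 * (length occurrences + 1) + (300 * (lifetime G * (length es + 1) + 1) +
           (card nodes + 1) * (200 * (n + 1) + 700)))
           (\<lambda>s. s ''out'' 0 = (if temporal_firefighter G r h then 1 else 0))"
        proof (rule runs_Seq[OF runs_active[OF ok4 p4 r4 act4] _ order_refl])
          fix s5 assume a5: "activity s5 (set occurrences)"
            and f5: "\<And>x. x \<notin> modified active_prog \<Longrightarrow> s5 x = s4 x"
          have ok5: "input_ok s5" by (rule iffD2[OF input_ok_cong ok4], rule f5) auto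
          have l5: "s5 ''life'' 0 = int (lifetime G)"
            "\<forall>e\<le>length es. s5 ''row'' (int e) = int (e * (lifetime G + 1))"
            using f4 f5 l3 r4 by simp_all
          show "runs (schedule_prog ;; search_prog) s5
             (300 * (lifetime G * (length es + 1) + 1) + (card nodes + 1) * (200 * (n + 1) + 700))
             (\<lambda>s. s ''out'' 0 = (if temporal_firefighter G r h then 1 else 0))"
          proof (rule runs_Seq[OF runs_schedule[OF ok5 l5 a5] _ order_refl])
            fix s6 assume o6: "represents_ops ops s6"
              and f6: "\<And>x. x \<notin> modified schedule_prog \<Longrightarrow> s6 x = s5 x"
            have ok6: "input_ok s6" by (rule iffD2[OF input_ok_cong ok5], rule f6) auto
            have "s6 ''h'' = ?s0 ''h''" "s6 ''w'' = s1 ''w''" "s6 ''mark'' = ?s0 ''mark''" "s6 ''last'' = s5 ''last''"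
              using f1 f2 f3 f4 f5 f6 by simp_all
            then have "search_input h s6" "s6 ''root'' 0 = int r" "s6 ''mark'' = (\<lambda>_. 0)"
              using ok6 o6 s0h w1 a5 zero later_occurrences by auto
            then show "runs search_prog s6 ((card nodes + 1) * (200 * (n + 1) + 700))
               (\<lambda>s. s ''out'' 0 = (if temporal_firefighter G r h then 1 else 0))"
              by (rule runs_search)
          qed
        qed
      qed
    qed
  qed
qed

text \<open>\<open>max 1\<close> matters for lifetime 0, where the bound would otherwise vanish
  although initialisation still takes time. The search dominates; all other stages are absorbed as
  lower-order terms.\<close>

lemma total_bound_le:
  "total_bound \<le> 100000 * (max 1 (lifetime G) * n ^ 5 * 3 ^ (2 * vim_width G))"
proof -
  define L where "L = max 1 (lifetime G)"
  define P where "P = (3 ^ (2 * vim_width G) :: nat)"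
  define X where "X = L * n ^ 5 * P"
  have L: "1 \<le> L" "lifetime G \<le> L" by (auto simp: L_def)
  have n: "1 \<le> n" using root_less by simp
  have P: "1 \<le> P" "4 ^ vim_width G \<le> P" by (auto simp: P_def power_mult power_mono)
  \<comment> \<open>As \<open>n\<close> and \<open>P\<close> are at least 1, \<open>X\<close>
    dominates every term of lower degree in \<open>n\<close>.\<close>
  have X: "a * n ^ i \<le> X" if "a \<le> L" "i \<le> 5" for a i
    using mult_le_mono[OF mult_le_mono[OF that(1) power_increasing[OF that(2) n]] P(1)] by (simp add: X_def)
  have X0: "1 \<le> X" "n \<le> X" "n ^ 2 \<le> X" "L * n ^ 2 \<le> X"
    using X[of 1 0] X[of 1 1] X[of 1 2] X[of L 2] L by simp_all
  have sq: "1 \<le> n ^ 2" using n by simp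
  have es: "length es \<le> n ^ 2" by (rule number_of_edges)
  have "n ^ 2 * (lifetime G + 3) \<le> n ^ 2 * (4 * L)" by (rule mult_le_mono) (use L in auto)
  also have "\<dots> = 4 * (L * n ^ 2)" by simp
  finally have 2: "n ^ 2 * (lifetime G + 3) \<le> 4 * X" using X0(4) by linarith
  have "length occurrences \<le> n ^ 2 * (2 * L)"
    by (rule le_trans[OF length_occurrences mult_le_mono[OF es]]) (use L in auto)
  also have "\<dots> = 2 * (L * n ^ 2)" by simp
  finally have 3: "length occurrences \<le> 2 * X" using X0(4) by linarith
  have "lifetime G * (length es + 1) \<le> L * (2 * n ^ 2)"
    by (rule mult_le_mono) (use L es sq in auto)
  also have "\<dots> = 2 * (L * n ^ 2)" by simp
  finally have 5: "lifetime G * (length es + 1) \<le> 2 * X" using X0(4) by linarith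
  have "length ops \<le> L * (3 * n ^ 2)"
    by (rule le_trans[OF length_schedule mult_le_mono]) (use L es sq in auto)
  also have "\<dots> = 3 * (L * n ^ 2)" by simp
  finally have "length ops \<le> 3 * (L * n ^ 2)" .
  moreover have "1 \<le> L * n ^ 2" using mult_le_mono[OF L(1) sq] by simp
  ultimately have ops: "length ops + 1 \<le> 4 * (L * n ^ 2)" by linarith
  have "(n + 1) ^ 2 \<le> (2 * n) ^ 2" by (rule power_mono) (use n in auto)
  then have "4 ^ (vim_width G + 1) * (n + 1) ^ 2 \<le> (4 * P) * (4 * n ^ 2)"
    by (intro mult_le_mono) (use P in \<open>auto simp: power_mult_distrib\<close>)
  then have "(length ops + 1) * (4 ^ (vim_width G + 1) * (n + 1) ^ 2) \<le> (4 * (L * n ^ 2)) * ((4 * P) * (4 * n ^ 2))"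
    by (rule mult_le_mono[OF ops])
  \<comment> \<open>One factor 4 comes from the number of layers, one from the status of the root,
    and one from \<open>(n + 1) ^ 2 \<le> 4 * n ^ 2\<close>.\<close>
  also have "\<dots> = 64 * (L * n ^ 4 * P)" by (simp add: power_add[of n 2 2, simplified])
  finally have "card nodes \<le> 64 * (L * n ^ 4 * P)" using card_nodes(2) by linarith
  moreover have "1 \<le> L * n ^ 4 * P" using L n P by simp
  ultimately have "card nodes + 1 \<le> 65 * (L * n ^ 4 * P)" by linarith
  \<comment> \<open>For \<open>n \<ge> 1\<close>, \<open>200 * (n + 1) + 700 \<le> 1100 * n\<close>;
    and \<open>65 * 1100 = 71500\<close>.\<close>
  then have "(card nodes + 1) * (200 * (n + 1) + 700) \<le> (65 * (L * n ^ 4 * P)) * (1100 * n)"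
    by (rule mult_le_mono) (use n in auto)
  also have "\<dots> = 71500 * X" by (simp add: X_def power_Suc2[of n 4, simplified])
  finally have 6: "(card nodes + 1) * (200 * (n + 1) + 700) \<le> 71500 * X" .
  \<comment> \<open>All stages before the search add at most \<open>2300 * X\<close>, so 100000 is a
    round upper bound.\<close>
  have "200 * (n + 1) + (100 * (a + 1) + (40 * (b + 1) + (40 * (c + 1) + (100 * (b + 1) +
      (300 * (d + 1) + e))))) \<le> 100000 * X"
    if "a \<le> 4 * X" "b \<le> 2 * X" "c \<le> X" "d \<le> 2 * X" "e \<le> 71500 * X" for a b c d e
    using that X0(1,2) by simp
  from this[OF 2 3 le_trans[OF es X0(3)] 5 6] have "total_bound \<le> 100000 * X"
    unfolding total_bound_def .
  then show ?thesis by (simp add: X_def L_def P_def)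
qed

end

theorem mainTheorem10:
  "\<exists>(p :: com) (C :: nat).
     \<forall>(G :: nat tgraph) (n :: nat) (r :: nat) (h :: int) (es :: (nat \<times> nat \<times> nat list) list).
       temporal_graph G \<and> verts G = {..<n} \<and> r \<in> verts G \<and> enumerates es G \<longrightarrow>
       (\<exists>T s. exec p (input_store n es r h) T s \<and>
          s ''out'' 0 = (if temporal_firefighter G r h then 1 else 0) \<and>
          T \<le> C * (max 1 (lifetime G) * n ^ 5 * 3 ^ (2 * vim_width G)))"
proof (rule exI[of _ firefighter_prog], rule exI[of _ 100000], intro allI impI, elim conjE)
  fix G :: "nat tgraph" and n r :: nat and h :: int and es :: "(nat \<times> nat \<times> nat list) list"
  assume "temporal_graph G" "verts G = {..<n}" "r \<in> verts G" "enumerates es G"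
  then interpret firefighter_input G n r es by unfold_locales
  obtain T s where "exec firefighter_prog (input_store n es r h) T s" "T \<le> total_bound"
    "s ''out'' 0 = (if temporal_firefighter G r h then 1 else 0)"
    using runs_firefighter[of h] unfolding runs_def by blast
  then show "\<exists>T s. exec firefighter_prog (input_store n es r h) T s \<and>
      s ''out'' 0 = (if temporal_firefighter G r h then 1 else 0) \<and>
      T \<le> 100000 * (max 1 (lifetime G) * n ^ 5 * 3 ^ (2 * vim_width G))"
    using total_bound_le by (meson le_trans)
qed

end
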